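(* Let $(M,D,J)$ be a 3-dimensional Sasakian manifold with defining equation $v=F(z,\bar z)$ in $\mathbb C^2$ with coordinates $(z=x+\mathrm i y,\ w=u+\mathrm i v)$, where $F$ is a smooth real function. Assume that the underlying Kähler manifold is Einstein with non-zero Einstein constant $\Lambda_o$, and let $\Lambda$ be any real number with $\Lambda\Lambda_o>0$. Then there exists a 4-dimensional Lorentzian manifold $(\mathscr M=M\times\mathbb R,\,g)$, which is a lift of $M$, such that $g$ is of Petrov type II or D and satisfies the Einstein equation $$\operatorname{Ric}(g)=\Lambda g.$$
   Context: CR manifolds. A 3-dimensional CR manifold $(M,D,J)$ is a 3-manifold $M$ with a rank 2 distribution $D\subset TM$ and a smooth field of endomorphisms $J\colon D\to D$, $J^2=-\mathrm{Id}$. It is strictly pseudoconvex if $[X,JX]\notin D$ at every point for every local non-vanishing section $X$ of $D$. For such $X$ put $\partial=X-\mathrm iJX$, $\partial_o=\mathrm i[\partial,\bar\partial]$; then $(\partial,\bar\partial,\partial_o)$ is called an adapted frame, and its dual coframe $(\mu,\bar\mu,\lambda)$ (abbreviated $(\mu,\lambda)$) an adapted coframe; $\mu$ is a complex 1-form, $\lambda$ a real 1-form, $\ker\lambda=D$, and $\mu|_D$ is a complex coordinate on $D$. The real hypersurface $v=F(z,\bar z)$ in $\mathbb C^2$ carries the CR structure $D=TM\cap \mathrm i\,TM$ with $J$ = multiplication by $\mathrm i$. Sasakian manifolds. A 3-dimensional Sasakian manifold is a strictly pseudoconvex 3-dimensional CR manifold endowed with a vector field $\mathscr Z$ transversal to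 $D$ with $\mathscr L_{\mathscr Z}D\subseteq D$ and $\mathscr L_{\mathscr Z}J=0$. For the hypersurface $v=F(z,\bar z)$ one takes $\mathscr Z=\partial_u$. The leaf space of the integral curves of $\partial_u$ is the domain of $F$ in $\mathbb C_z$; the underlying Kähler manifold is this domain with Kähler potential $F$ and Kähler metric $h=2F_{z\bar z}\,dz\,d\bar z$ (with $F_{z\bar z}>0$). It is Einstein with Einstein constant $\Lambda_o$ if $\operatorname{Ric}(h)=\Lambda_o h$, i.e. $-\partial_{z\bar z}\log(F_{z\bar z})=\Lambda_oF_{z\bar z}$. Lifts. The symmetric product of 1-forms is $\omega\gamma=\frac12(\omega\otimes\gamma+\gamma\otimes\omega)$. A lift of $(M,D,J)$ is $\mathscr M=M\times\mathbb R$ with a Lorentzian metric of the form $$g=2\mathscr P^2\left(\mu\bar\mu+\lambda\left(dr+\mathscr W\mu+\overline{\mathscr W}\bar\mu+\mathscr H\lambda\right)\right),$$ where $(\mu,\lambda)$ is (the pullback of) an adapted coframe on $M$, $\mathscr P\neq0$, $r$ and $\mathscr H$ are real functions on $\mathscr M$ and $\mathscr W$ is a complex function on $\mathscr M$. The vector field $\partial_r$ is then null and shearfree for $g$. Petrov type. Let $$e_1=\tfrac1{\mathscr P}(\partial-\mathscr W\partial_r),\quad e_2=\overline{e_1},\quad e_3=\tfrac1{\mathscr P}(\partial_o-\mathscr H\partial_r),\quad e_4=\tfrac1{\mathscr P}\partial_r$$ be the frame dual to $\theta^1=\mathscr P\mu$, $\theta^2=\mathscr P\bar\mu$, $\theta^3=\mathscr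 P\lambda$, $\theta^4=\mathscr P(dr+\mathscr W\mu+\overline{\mathscr W}\bar\mu+\mathscr H\lambda)$, so that $g=2(\theta^1\theta^2+\theta^3\theta^4)$. Here "$g$ is of Petrov type II or D" means that the components of the (complex-linearly extended) Weyl tensor $C$ with respect to this frame satisfy $C_{4141}=C_{4341}=0$ and $C_{4132}\neq0$. *)

theory Defs
  imports "HOL-Analysis.Analysis"
begin

section \<open>Smooth maps on open sets of a Euclidean space\<close>

definition dir_deriv ::
  "'a \<Rightarrow> ('a::real_normed_vector \<Rightarrow> 'b::real_normed_vector) \<Rightarrow> 'a \<Rightarrow> 'b"
  where "dir_deriv v f p = frechet_derivative f (at p) v"

text \<open>Only meant for open \<open>S\<close>: all iterated directional derivatives exist and are differentiable
  (hence continuous), which is the class of smooth maps.\<close>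

definition smooth_on ::
  "'a::real_normed_vector set \<Rightarrow> ('a \<Rightarrow> 'b::real_normed_vector) \<Rightarrow> bool"
  where "smooth_on S f \<longleftrightarrow> (\<forall>vs. fold dir_deriv vs f differentiable_on S)"

definition lie_bracket ::
  "('a::real_normed_vector \<Rightarrow> 'a) \<Rightarrow> ('a \<Rightarrow> 'a) \<Rightarrow> 'a \<Rightarrow> 'a"
  where "lie_bracket X Y p = dir_deriv (X p) Y p - dir_deriv (Y p) X p"

section \<open>Complexification\<close>

text \<open>A complex tangent vector \<open>a + \<i> b\<close> is represented by the pair \<open>(a, b)\<close> of its real and
  imaginary parts.  Complex 1-forms are real-linear maps into the complex numbers.\<close>

definition cx_ext :: "('a \<Rightarrow> complex) \<Rightarrow> 'a \<times> 'a \<Rightarrow> complex"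
  where "cx_ext f V = f (fst V) + \<i> * f (snd V)"

definition cx_ext4 ::
  "('a \<Rightarrow> 'a \<Rightarrow> 'a \<Rightarrow> 'a \<Rightarrow> real) \<Rightarrow> 'a \<times> 'a \<Rightarrow> 'a \<times> 'a \<Rightarrow> 'a \<times> 'a \<Rightarrow> 'a \<times> 'a \<Rightarrow> complex"
  where "cx_ext4 T V1 V2 V3 V4 =
    cx_ext (\<lambda>v1. cx_ext (\<lambda>v2. cx_ext (\<lambda>v3. cx_ext (\<lambda>v4.
      complex_of_real (T v1 v2 v3 v4)) V4) V3) V2) V1"

definition cx_conj :: "'a \<times> 'a \<Rightarrow> 'a \<times> 'a::real_vector"
  where "cx_conj V = (fst V, - snd V)"

definition cx_times_i :: "'a \<times> 'a \<Rightarrow> 'a \<times> 'a::real_vector"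
  where "cx_times_i V = (- snd V, fst V)"

definition cx_lie_bracket ::
  "('a::real_normed_vector \<Rightarrow> 'a \<times> 'a) \<Rightarrow> ('a \<Rightarrow> 'a \<times> 'a) \<Rightarrow> 'a \<Rightarrow> 'a \<times> 'a"
  where "cx_lie_bracket V W p =
    (lie_bracket (fst \<circ> V) (fst \<circ> W) p - lie_bracket (snd \<circ> V) (snd \<circ> W) p,
     lie_bracket (fst \<circ> V) (snd \<circ> W) p + lie_bracket (snd \<circ> V) (fst \<circ> W) p)"

definition sym_prod :: "('a \<Rightarrow> complex) \<Rightarrow> ('a \<Rightarrow> complex) \<Rightarrow> 'a \<Rightarrow> 'a \<Rightarrow> complex"
  where "sym_prod \<omega> \<gamma> v w = (\<omega> v * \<gamma> w + \<gamma> v * \<omega> w) / 2"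

section \<open>Pseudo-Riemannian metrics and their curvature\<close>

definition lorentzian_form :: "('a::euclidean_space \<Rightarrow> 'a \<Rightarrow> real) \<Rightarrow> bool"
  where "lorentzian_form b \<longleftrightarrow>
    bilinear b \<and> (\<forall>v w. b v w = b w v) \<and>
    (\<exists>E t. independent E \<and> span E = UNIV \<and> t \<in> E \<and> b t t = -1 \<and>
       (\<forall>e\<in>E - {t}. b e e = 1) \<and> (\<forall>e\<in>E. \<forall>e'\<in>E. e \<noteq> e' \<longrightarrow> b e e' = 0))"

definition lorentzian_metric_on ::
  "'a::euclidean_space set \<Rightarrow> ('a \<Rightarrow> 'a \<Rightarrow> 'a \<Rightarrow> real) \<Rightarrow> bool"
  where "lorentzian_metric_on S g \<longleftrightarrow>
    (\<forall>v w. smooth_on S (\<lambda>p. g p v w)) \<and> (\<forall>p\<in>S. lorentzian_form (g p))"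

definition sharp :: "('a \<Rightarrow> 'a \<Rightarrow> real) \<Rightarrow> ('a \<Rightarrow> real) \<Rightarrow> 'a"
  where "sharp b \<alpha> = (THE w. \<forall>v. b w v = \<alpha> v)"

text \<open>The Levi-Civita derivative \<open>\<nabla>\<^sub>x y\<close> of constant (coordinate) vector fields, by
  the Koszul formula; in a basis its components are the Christoffel symbols.\<close>

definition levi_civita ::
  "('a::euclidean_space \<Rightarrow> 'a \<Rightarrow> 'a \<Rightarrow> real) \<Rightarrow> 'a \<Rightarrow> 'a \<Rightarrow> 'a \<Rightarrow> 'a"
  where "levi_civita g p x y = sharp (g p) (\<lambda>z.
    (dir_deriv x (\<lambda>q. g q y z) p + dir_deriv y (\<lambda>q. g q x z) p
      - dir_deriv z (\<lambda>q. g q x y) p) / 2)"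

text \<open>\<open>riemann g p x y z = R(x,y)z = \<nabla>\<^sub>x \<nabla>\<^sub>y z - \<nabla>\<^sub>y \<nabla>\<^sub>x z\<close> for constant
  (hence commuting) vector fields.\<close>

definition riemann ::
  "('a::euclidean_space \<Rightarrow> 'a \<Rightarrow> 'a \<Rightarrow> real) \<Rightarrow> 'a \<Rightarrow> 'a \<Rightarrow> 'a \<Rightarrow> 'a \<Rightarrow> 'a"
  where "riemann g p x y z =
    dir_deriv x (\<lambda>q. levi_civita g q y z) p - dir_deriv y (\<lambda>q. levi_civita g q x z) p
    + levi_civita g p x (levi_civita g p y z) - levi_civita g p y (levi_civita g p x z)"

text \<open>Trace of \<open>x \<mapsto> R(x,y)z\<close>, so that round spheres have positive Ricci curvature.\<close>

definition ricci ::
  "('a::euclidean_space \<Rightarrow> 'a \<Rightarrow> 'a \<Rightarrow> real) \<Rightarrow> 'a \<Rightarrow> 'a \<Rightarrow> 'a \<Rightarrow> real"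
  where "ricci g p y z = (\<Sum>b\<in>Basis. riemann g p b y z \<bullet> b)"

definition scalar_curvature ::
  "('a::euclidean_space \<Rightarrow> 'a \<Rightarrow> 'a \<Rightarrow> real) \<Rightarrow> 'a \<Rightarrow> real"
  where "scalar_curvature g p = (\<Sum>b\<in>Basis. sharp (g p) (ricci g p b) \<bullet> b)"

text \<open>The Weyl tensor in dimension at least 3, with all indices lowered; the sign convention is
  \<open>R\<^sub>a\<^sub>b\<^sub>c\<^sub>d = g(R(e\<^sub>a,e\<^sub>b)e\<^sub>d, e\<^sub>c)\<close>.\<close>

definition weyl ::
  "('a::euclidean_space \<Rightarrow> 'a \<Rightarrow> 'a \<Rightarrow> real) \<Rightarrow> 'a \<Rightarrow> 'a \<Rightarrow> 'a \<Rightarrow> 'a \<Rightarrow> 'a \<Rightarrow> real"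
  where "weyl g p a b c d =
    g p (riemann g p a b d) c
    - (g p a c * ricci g p b d - g p a d * ricci g p b c
       - g p b c * ricci g p a d + g p b d * ricci g p a c) / (real DIM('a) - 2)
    + scalar_curvature g p * (g p a c * g p b d - g p a d * g p b c)
        / ((real DIM('a) - 1) * (real DIM('a) - 2))"

definition einstein_on ::
  "'a::euclidean_space set \<Rightarrow> ('a \<Rightarrow> 'a \<Rightarrow> 'a \<Rightarrow> real) \<Rightarrow> real \<Rightarrow> bool"
  where "einstein_on S g k \<longleftrightarrow> (\<forall>p\<in>S. \<forall>v w. ricci g p v w = k * g p v w)"

section \<open>CR and Sasakian structures\<close>

text \<open>A manifold is given by a global chart, an open set \<open>S\<close>; \<open>D p\<close> is the plane of the
  distribution at \<open>p\<close>, and \<open>J p\<close> is only meaningful on \<open>D p\<close>.\<close>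

definition nonvanishing_section ::
  "'m::euclidean_space set \<Rightarrow> ('m \<Rightarrow> 'm set) \<Rightarrow> ('m \<Rightarrow> 'm) \<Rightarrow> bool"
  where "nonvanishing_section V D X \<longleftrightarrow> smooth_on V X \<and> (\<forall>p\<in>V. X p \<in> D p \<and> X p \<noteq> 0)"

text \<open>Smoothness of \<open>D\<close> and \<open>J\<close> is expressed by local smooth frames \<open>(X, J X)\<close> of \<open>D\<close>.\<close>

definition cr_manifold3 ::
  "'m::euclidean_space set \<Rightarrow> ('m \<Rightarrow> 'm set) \<Rightarrow> ('m \<Rightarrow> 'm \<Rightarrow> 'm) \<Rightarrow> bool"
  where "cr_manifold3 S D J \<longleftrightarrow>
    DIM('m) = 3 \<and> open S \<and>
    (\<forall>p\<in>S. subspace (D p) \<and> dim (D p) = 2 \<and>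
      (\<forall>v\<in>D p. J p v \<in> D p \<and> J p (J p v) = - v) \<and>
      (\<forall>v\<in>D p. \<forall>w\<in>D p. \<forall>a b. J p (a *\<^sub>R v + b *\<^sub>R w) = a *\<^sub>R J p v + b *\<^sub>R J p w)) \<and>
    (\<forall>p\<in>S. \<exists>V X. open V \<and> p \<in> V \<and> V \<subseteq> S \<and> nonvanishing_section V D X \<and>
      smooth_on V (\<lambda>q. J q (X q)))"

definition strictly_pseudoconvex ::
  "'m::euclidean_space set \<Rightarrow> ('m \<Rightarrow> 'm set) \<Rightarrow> ('m \<Rightarrow> 'm \<Rightarrow> 'm) \<Rightarrow> bool"
  where "strictly_pseudoconvex S D J \<longleftrightarrow>
    (\<forall>V X. open V \<and> V \<subseteq> S \<and> nonvanishing_section V D X \<longrightarrow>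
      (\<forall>p\<in>V. lie_bracket X (\<lambda>q. J q (X q)) p \<notin> D p))"

text \<open>The last two clauses are \<open>L\<^sub>Z D \<subseteq> D\<close> and \<open>L\<^sub>Z J = 0\<close>.\<close>

definition sasakian_manifold3 ::
  "'m::euclidean_space set \<Rightarrow> ('m \<Rightarrow> 'm set) \<Rightarrow> ('m \<Rightarrow> 'm \<Rightarrow> 'm) \<Rightarrow> ('m \<Rightarrow> 'm) \<Rightarrow> bool"
  where "sasakian_manifold3 S D J Z \<longleftrightarrow>
    cr_manifold3 S D J \<and> strictly_pseudoconvex S D J \<and>
    smooth_on S Z \<and> (\<forall>p\<in>S. Z p \<notin> D p) \<and>
    (\<forall>V X. open V \<and> V \<subseteq> S \<and> smooth_on V X \<and> (\<forall>p\<in>V. X p \<in> D p) \<longrightarrow>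
      (\<forall>p\<in>V. lie_bracket Z X p \<in> D p \<and>
        lie_bracket Z (\<lambda>q. J q (X q)) p = J p (lie_bracket Z X p)))"

text \<open>\<open>\<partial> = X - \<i> J X\<close> and \<open>\<partial>\<^sub>o = \<i> [\<partial>, cnj \<partial>]\<close>\<close>

definition adapted_del :: "('m \<Rightarrow> 'm \<Rightarrow> 'm) \<Rightarrow> ('m \<Rightarrow> 'm) \<Rightarrow> 'm \<Rightarrow> 'm \<times> 'm::real_vector"
  where "adapted_del J X p = (X p, - J p (X p))"

definition adapted_del_o ::
  "('m \<Rightarrow> 'm \<Rightarrow> 'm) \<Rightarrow> ('m \<Rightarrow> 'm) \<Rightarrow> 'm \<Rightarrow> 'm \<times> 'm::real_normed_vector"
  where "adapted_del_o J X p =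
    cx_times_i (cx_lie_bracket (adapted_del J X) (\<lambda>q. cx_conj (adapted_del J X q)) p)"

definition adapted_coframe ::
  "'m::euclidean_space set \<Rightarrow> ('m \<Rightarrow> 'm set) \<Rightarrow> ('m \<Rightarrow> 'm \<Rightarrow> 'm) \<Rightarrow>
   ('m \<Rightarrow> 'm \<Rightarrow> complex) \<Rightarrow> ('m \<Rightarrow> 'm \<Rightarrow> real) \<Rightarrow> bool"
  where "adapted_coframe S D J \<mu> lam \<longleftrightarrow>
    (\<exists>X. nonvanishing_section S D X \<and>
      (\<forall>p\<in>S. linear (\<mu> p) \<and> linear (lam p) \<and>
        cx_ext (\<mu> p) (adapted_del J X p) = 1 \<and>
        cx_ext (\<mu> p) (cx_conj (adapted_del J X p)) = 0 \<and>
        cx_ext (\<mu> p) (adapted_del_o J X p) = 0 \<and>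
        cx_ext (\<lambda>v. complex_of_real (lam p v)) (adapted_del J X p) = 0 \<and>
        cx_ext (\<lambda>v. complex_of_real (lam p v)) (cx_conj (adapted_del J X p)) = 0 \<and>
        cx_ext (\<lambda>v. complex_of_real (lam p v)) (adapted_del_o J X p) = 1))"

section \<open>The hypersurface \<open>v = F(z)\<close>\<close>

text \<open>The hypersurface \<open>{(z, w). z \<in> U \<and> Im w = F z}\<close> is the image of \<open>U \<times> \<real>\<close> under
  the global parametrization \<open>(z, u) \<mapsto> (z, u + \<i> F z)\<close>; its CR structure
  (\<open>D = TM \<inter> \<i> TM\<close>, with \<open>J\<close> the multiplication by \<open>\<i>\<close>) is pulled back to \<open>U \<times> \<real>\<close>.\<close>

definition hyp_param :: "(complex \<Rightarrow> real) \<Rightarrow> complex \<times> real \<Rightarrow> complex \<times> complex"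
  where "hyp_param F p = (fst p, Complex (snd p) (F (fst p)))"

definition mult_i :: "complex \<times> complex \<Rightarrow> complex \<times> complex"
  where "mult_i c = (\<i> * fst c, \<i> * snd c)"

definition hyp_tangent :: "(complex \<Rightarrow> real) \<Rightarrow> complex \<times> real \<Rightarrow> (complex \<times> complex) set"
  where "hyp_tangent F p = range (frechet_derivative (hyp_param F) (at p))"

definition hyp_D :: "(complex \<Rightarrow> real) \<Rightarrow> complex \<times> real \<Rightarrow> (complex \<times> real) set"
  where "hyp_D F p =
    {v. frechet_derivative (hyp_param F) (at p) v \<in> hyp_tangent F p \<inter> mult_i ` hyp_tangent F p}"

definition hyp_J :: "(complex \<Rightarrow> real) \<Rightarrow> complex \<times> real \<Rightarrow> complex \<times> real \<Rightarrow> complex \<times> real"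
  where "hyp_J F p v =
    (THE v'. frechet_derivative (hyp_param F) (at p) v'
           = mult_i (frechet_derivative (hyp_param F) (at p) v))"

definition d_z :: "(complex \<Rightarrow> complex) \<Rightarrow> complex \<Rightarrow> complex"
  where "d_z f p = (dir_deriv 1 f p - \<i> * dir_deriv \<i> f p) / 2"

definition d_zbar :: "(complex \<Rightarrow> complex) \<Rightarrow> complex \<Rightarrow> complex"
  where "d_zbar f p = (dir_deriv 1 f p + \<i> * dir_deriv \<i> f p) / 2"

text \<open>The mixed derivative of the real function \<open>F\<close> is real.\<close>

definition F_zzbar :: "(complex \<Rightarrow> real) \<Rightarrow> complex \<Rightarrow> real"
  where "F_zzbar F p = Re (d_zbar (d_z (\<lambda>q. complex_of_real (F q))) p)"

text \<open>\<open>h = 2 F\<^sub>z\<^sub>z\<^sub>b\<^sub>a\<^sub>r dz dzbar\<close>, a symmetric product\<close>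

definition kaehler_metric :: "(complex \<Rightarrow> real) \<Rightarrow> complex \<Rightarrow> complex \<Rightarrow> complex \<Rightarrow> real"
  where "kaehler_metric F p v w = 2 * F_zzbar F p * Re (sym_prod (\<lambda>v. v) cnj v w)"

section \<open>Lifts and their Petrov type\<close>

text \<open>The form \<open>dr + W \<mu> + cnj W cnj \<mu> + H \<lambda>\<close> on \<open>M \<times> \<real>\<close>.  Here \<open>r\<close> is a function on the
  product, not necessarily the second projection: nondegeneracy of the lifted metric forces it to
  restrict to a local coordinate on each fibre.\<close>

definition lift_form ::
  "('m::euclidean_space \<Rightarrow> 'm \<Rightarrow> complex) \<Rightarrow> ('m \<Rightarrow> 'm \<Rightarrow> real) \<Rightarrow> ('m \<times> real \<Rightarrow> real) \<Rightarrow>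
   ('m \<times> real \<Rightarrow> complex) \<Rightarrow> ('m \<times> real \<Rightarrow> real) \<Rightarrow>
   'm \<times> real \<Rightarrow> 'm \<times> real \<Rightarrow> complex"
  where "lift_form \<mu> lam r W H p v =
    complex_of_real (frechet_derivative r (at p) v)
    + W p * \<mu> (fst p) (fst v) + cnj (W p) * cnj (\<mu> (fst p) (fst v))
    + complex_of_real (H p * lam (fst p) (fst v))"

definition lift_of ::
  "'m::euclidean_space set \<Rightarrow> ('m \<Rightarrow> 'm set) \<Rightarrow> ('m \<Rightarrow> 'm \<Rightarrow> 'm) \<Rightarrow>
   ('m \<times> real \<Rightarrow> 'm \<times> real \<Rightarrow> 'm \<times> real \<Rightarrow> real) \<Rightarrow>
   ('m \<Rightarrow> 'm \<Rightarrow> complex) \<Rightarrow> ('m \<Rightarrow> 'm \<Rightarrow> real) \<Rightarrow> ('m \<times> real \<Rightarrow> real) \<Rightarrow>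
   ('m \<times> real \<Rightarrow> real) \<Rightarrow> ('m \<times> real \<Rightarrow> complex) \<Rightarrow> ('m \<times> real \<Rightarrow> real) \<Rightarrow> bool"
  where "lift_of S D J g \<mu> lam P r W H \<longleftrightarrow>
    adapted_coframe S D J \<mu> lam \<and>
    smooth_on (S \<times> UNIV) P \<and> smooth_on (S \<times> UNIV) r \<and>
    smooth_on (S \<times> UNIV) W \<and> smooth_on (S \<times> UNIV) H \<and>
    (\<forall>p\<in>S \<times> UNIV. P p \<noteq> 0) \<and>
    lorentzian_metric_on (S \<times> UNIV) g \<and>
    (\<forall>p\<in>S \<times> UNIV. \<forall>v w. complex_of_real (g p v w) =
      2 * (complex_of_real (P p))\<^sup>2 *
       (sym_prod (\<lambda>v. \<mu> (fst p) (fst v)) (\<lambda>v. cnj (\<mu> (fst p) (fst v))) v w +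
        sym_prod (\<lambda>v. complex_of_real (lam (fst p) (fst v))) (lift_form \<mu> lam r W H p) v w))"

text \<open>\<open>\<theta>\<^sup>1, \<dots>, \<theta>\<^sup>4\<close>, indexed from 1\<close>

definition lift_coframe ::
  "('m::euclidean_space \<Rightarrow> 'm \<Rightarrow> complex) \<Rightarrow> ('m \<Rightarrow> 'm \<Rightarrow> real) \<Rightarrow> ('m \<times> real \<Rightarrow> real) \<Rightarrow>
   ('m \<times> real \<Rightarrow> real) \<Rightarrow> ('m \<times> real \<Rightarrow> complex) \<Rightarrow> ('m \<times> real \<Rightarrow> real) \<Rightarrow>
   nat \<Rightarrow> 'm \<times> real \<Rightarrow> 'm \<times> real \<Rightarrow> complex"
  where "lift_coframe \<mu> lam P r W H i p v = complex_of_real (P p) *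
    (if i = 1 then \<mu> (fst p) (fst v)
     else if i = 2 then cnj (\<mu> (fst p) (fst v))
     else if i = 3 then complex_of_real (lam (fst p) (fst v))
     else lift_form \<mu> lam r W H p v)"

text \<open>The (unique) dual frame \<open>e\<^sub>1, \<dots>, e\<^sub>4\<close> of the coframe; in particular \<open>P e\<^sub>4 = \<partial>\<^sub>r\<close>.\<close>

definition petrov_II_or_D_on ::
  "'a::euclidean_space set \<Rightarrow> ('a \<Rightarrow> 'a \<Rightarrow> 'a \<Rightarrow> real) \<Rightarrow> (nat \<Rightarrow> 'a \<Rightarrow> 'a \<Rightarrow> complex) \<Rightarrow> bool"
  where "petrov_II_or_D_on S g \<theta> \<longleftrightarrow>
    (\<forall>p\<in>S. \<exists>e. (\<forall>i\<in>{1..4}. \<forall>j\<in>{1..4}. cx_ext (\<theta> i p) (e j) = (if i = j then 1 else 0)) \<and>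
      cx_ext4 (weyl g p) (e 4) (e 1) (e 4) (e 1) = 0 \<and>
      cx_ext4 (weyl g p) (e 4) (e 3) (e 4) (e 1) = 0 \<and>
      cx_ext4 (weyl g p) (e 4) (e 1) (e 3) (e (2::nat)) \<noteq> 0)"

end

theory Submission
  imports Defs
begin

text \<open>
  Write \<open>f = F\<^sub>z\<^sub>z\<^sub>b\<^sub>a\<^sub>r\<close>, let \<open>h = 2 f dz dzbar\<close> be the Kaehler metric, \<open>k\<close> its Einstein constant and
  \<open>\<alpha> = du - \<i> F\<^sub>z dz + \<i> F\<^sub>z\<^sub>b\<^sub>a\<^sub>r dzbar\<close> the contact form.  Since \<open>d\<alpha>\<close> is twice the Kaehler form of
  \<open>h\<close>, the hypersurface is a Boothby-Wang type line bundle over a surface of constant curvature,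
  and a Taub-NUT-(anti-)de Sitter metric lives on its product with a line.  With fibre coordinate
  \<open>s\<close> and \<open>\<phi> = 1 + s\<^sup>2\<close> the metrics considered are
  \<open>g = c (\<phi> h + 2 \<alpha> ds + B(s) \<alpha>\<^sup>2)\<close>,
  where \<open>c > 0\<close> is a constant.  The adapted coframe is \<open>\<mu> = dz\<close>, \<open>\<lambda> = \<alpha> / (2 f)\<close>, so \<open>g\<close> is the lift with
  \<open>P\<^sup>2 = c \<phi> f\<close>, \<open>r = 2 arctan s\<close>, \<open>W = 0\<close> and \<open>H = 2 f B / \<phi>\<close> (\<open>lift_of_G\<close>).

  The Levi-Civita connection is found from the Koszul formula (\<open>levi_civita_G\<close>).  It is best written
  in the components of a vector along the base, along \<open>\<alpha>\<close> and along \<open>ds\<close>: the potential then occurs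
  only through \<open>f\<close>, the Christoffel symbol \<open>\<partial>\<^sub>z log f\<close> of \<open>h\<close> and the derivatives of the coefficients
  of \<open>\<alpha>\<close>, and the last cancel from the curvature except for \<open>d\<alpha>\<close>.  The Einstein equation of \<open>h\<close>
  says \<open>\<partial>\<^sub>z\<^sub>b\<^sub>a\<^sub>r \<partial>\<^sub>z log f = - k f\<close>, and the trace of the curvature becomes (\<open>ricci_G\<close>)
  \<open>Ric = (k - 2 B/\<phi> + s B' + B) h + (B''/2 + (s B' + 2 B/\<phi>) / \<phi>) (2 \<alpha> ds + B \<alpha>\<^sup>2)\<close>.
  Hence \<open>Ric = \<Lambda> g\<close> amounts to two linear differential equations for \<open>B\<close>.  If \<open>\<Lambda> c = 3 k / 4\<close>,
  they are solved by \<open>B = k \<phi> / 4 + m s / \<phi>\<close> with an arbitrary constant \<open>m\<close>; the condition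
  \<open>\<Lambda> k > 0\<close> makes \<open>c = 3 k / (4 \<Lambda>)\<close> positive.

  For \<open>m = 0\<close> this is a space of constant curvature.  In general the Weyl components \<open>C\<^sub>4\<^sub>1\<^sub>4\<^sub>1\<close> and
  \<open>C\<^sub>4\<^sub>3\<^sub>4\<^sub>1\<close> vanish because \<open>R(\<partial>\<^sub>s, v) w\<close> has no \<open>\<alpha>\<close>-component when \<open>w\<close> is horizontal, and \<open>C\<^sub>4\<^sub>1\<^sub>3\<^sub>2\<close> is
  \<open>- m / (2 c (s + \<i>)\<^sup>3)\<close>, which has no zeros if \<open>m \<noteq> 0\<close> (\<open>weyl_components\<close>, \<open>petrov_G\<close>).  The proof
  takes \<open>m = 1\<close>.
\<close>

section \<open>Directional derivatives\<close>

lemma dir_deriv_eqI: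
  assumes "(f has_derivative f') (at p)"
  shows "dir_deriv v f p = f' v"
  using frechet_derivative_at[OF assms] by (simp add: dir_deriv_def)

lemma has_derivative_dir_deriv:
  assumes "f differentiable at p"
  shows "(f has_derivative (\<lambda>v. dir_deriv v f p)) (at p)"
  using assms by (simp add: dir_deriv_def frechet_derivative_works)

lemma linear_dir_deriv:
  assumes "f differentiable at p"
  shows "linear (\<lambda>v. dir_deriv v f p)"
  using has_derivative_linear[OF has_derivative_dir_deriv[OF assms]] .

lemma has_derivative_cong_open:
  assumes "open S" "p \<in> S" "\<And>q. q \<in> S \<Longrightarrow> f q = g q"
  shows "(f has_derivative f') (at p) \<longleftrightarrow> (g has_derivative f') (at p)"
proof
  show "(g has_derivative f') (at p)" if "(f has_derivative f') (at p)"
    using has_derivative_transform_within_open[OF that assms(1,2)] assms(3) by simp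
  show "(f has_derivative f') (at p)" if "(g has_derivative f') (at p)"
    using has_derivative_transform_within_open[OF that assms(1,2)] assms(3) by simp
qed

lemma dir_deriv_cong_open:
  assumes "open S" "p \<in> S" "\<And>q. q \<in> S \<Longrightarrow> f q = g q"
  shows "dir_deriv v f p = dir_deriv v g p"
  using has_derivative_cong_open[OF assms]
  by (simp add: dir_deriv_def frechet_derivative_def)

lemma differentiable_on_cong_open:
  assumes "open S" "\<And>q. q \<in> S \<Longrightarrow> f q = g q"
  shows "f differentiable_on S \<longleftrightarrow> g differentiable_on S"
  using has_derivative_cong_open[OF assms(1) _ assms(2)] assms(1)
  by (simp add: differentiable_on_eq_differentiable_at differentiable_def)

lemma fold_dir_deriv_cong_open:
  assumes "open S" "\<And>q. q \<in> S \<Longrightarrow> f q = g q" "p \<in> S"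
  shows "fold dir_deriv vs f p = fold dir_deriv vs g p"
  using assms(2,3)
proof (induction vs arbitrary: f g p)
  case (Cons v vs)
  have "dir_deriv v f q = dir_deriv v g q" if "q \<in> S" for q
    using dir_deriv_cong_open[OF assms(1) that] Cons.prems(1) by blast
  then show ?case
    using Cons.IH[of "dir_deriv v f" "dir_deriv v g"] Cons.prems(2) by simp
qed simp

section \<open>Smooth maps\<close>

lemma smooth_on_cong:
  assumes "open S" "\<And>q. q \<in> S \<Longrightarrow> f q = g q"
  shows "smooth_on S f \<longleftrightarrow> smooth_on S g"
proof -
  have "fold dir_deriv vs f differentiable_on S \<longleftrightarrow> fold dir_deriv vs g differentiable_on S" for vs
    by (rule differentiable_on_cong_open[OF assms(1) fold_dir_deriv_cong_open[OF assms]])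
  then show ?thesis
    by (simp add: smooth_on_def)
qed

lemma smooth_on_differentiable:
  assumes "smooth_on S f" "open S" "p \<in> S"
  shows "f differentiable at p"
  using assms(1)[unfolded smooth_on_def, rule_format, of "[]"] assms(2,3)
  by (simp add: differentiable_on_eq_differentiable_at)

lemma smooth_on_has_derivative:
  assumes "smooth_on S f" "open S" "p \<in> S"
  shows "(f has_derivative (\<lambda>v. dir_deriv v f p)) (at p)"
  using has_derivative_dir_deriv[OF smooth_on_differentiable[OF assms]] .

lemma smooth_on_dir_deriv:
  assumes "smooth_on S f"
  shows "smooth_on S (dir_deriv v f)"
  unfolding smooth_on_def
proof
  fix vs
  show "fold dir_deriv vs (dir_deriv v f) differentiable_on S"
    using assms[unfolded smooth_on_def, rule_format, of "v # vs"] by simp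
qed

text \<open>Smoothness is a greatest fixed point: it holds for all members of a class of maps that are
  differentiable on \<open>S\<close> and whose directional derivatives agree on \<open>S\<close> with members of the class.
  The closure properties below are instances with a suitable class.\<close>

lemma smooth_on_coinduct:
  assumes "open S" "C f"
    and step: "\<And>f v. C f \<Longrightarrow> \<exists>D. (\<forall>p\<in>S. (f has_derivative D p) (at p)) \<and> C (\<lambda>p. D p v)"
  shows "smooth_on S f"
  unfolding smooth_on_def
proof
  fix vs
  show "fold dir_deriv vs f differentiable_on S"
    using \<open>C f\<close>
  proof (induction vs arbitrary: f)
    case Nil
    obtain D where "\<forall>p\<in>S. (f has_derivative D p) (at p)"
      using step[OF Nil, of undefined] by (elim exE conjE)
    then have "\<forall>p\<in>S. f differentiable at p"
      using differentiableI by blast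
    then show ?case
      using \<open>open S\<close> by (simp add: differentiable_on_eq_differentiable_at)
  next
    case (Cons v vs)
    obtain D where D: "\<forall>p\<in>S. (f has_derivative D p) (at p)" and D2: "C (\<lambda>p. D p v)"
      using step[OF Cons.prems, of v] by (elim exE conjE)
    have D1: "(f has_derivative D p) (at p)" if "p \<in> S" for p
      by (rule bspec[OF D that])
    have "fold dir_deriv vs (\<lambda>p. D p v) differentiable_on S"
      by (rule Cons.IH[OF D2])
    moreover have "fold dir_deriv vs (dir_deriv v f) p = fold dir_deriv vs (\<lambda>p. D p v) p"
      if "p \<in> S" for p
      by (rule fold_dir_deriv_cong_open[OF \<open>open S\<close> dir_deriv_eqI[OF D1] that])
    ultimately show ?case
      using differentiable_on_cong_open[OF \<open>open S\<close>, of "fold dir_deriv vs (dir_deriv v f)"] by simp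
  qed
qed

lemma smooth_on_const: "open S \<Longrightarrow> smooth_on S (\<lambda>_. c)"
  by (rule smooth_on_coinduct[where C = "\<lambda>f. \<exists>c. f = (\<lambda>_. c)"])
    (auto intro!: exI[of _ "\<lambda>_ _. 0"])

lemma smooth_on_bounded_linear:
  assumes "open S" "bounded_linear L"
  shows "smooth_on S L"
proof (rule smooth_on_coinduct[where C = "\<lambda>f. f = L \<or> (\<exists>c. f = (\<lambda>_. c))"])
  fix f :: "'a \<Rightarrow> 'b" and v
  assume "f = L \<or> (\<exists>c. f = (\<lambda>_. c))"
  then show "\<exists>D. (\<forall>p\<in>S. (f has_derivative D p) (at p)) \<and>
      ((\<lambda>p. D p v) = L \<or> (\<exists>c. (\<lambda>p. D p v) = (\<lambda>_. c)))"
  proof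
    assume "f = L"
    then show ?thesis
      using bounded_linear_imp_has_derivative[OF assms(2)] by (intro exI[of _ "\<lambda>_. L"]) auto
  next
    assume "\<exists>c. f = (\<lambda>_. c)"
    then show ?thesis
      by (intro exI[of _ "\<lambda>_ _. 0"]) auto
  qed
qed (use assms in auto)

lemma smooth_on_ident: "open S \<Longrightarrow> smooth_on S (\<lambda>x. x)"
  by (rule smooth_on_bounded_linear[OF _ bounded_linear_ident])

lemma smooth_on_o_linear:
  assumes "open S" "open T" "bounded_linear L" "\<And>p. p \<in> S \<Longrightarrow> L p \<in> T" "smooth_on T f"
  shows "smooth_on S (\<lambda>p. f (L p))"
proof (rule smooth_on_coinduct[where C = "\<lambda>f. \<exists>g. smooth_on T g \<and> f = (\<lambda>p. g (L p))"])
  fix h :: "'a \<Rightarrow> 'c" and v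
  assume "\<exists>g. smooth_on T g \<and> h = (\<lambda>p. g (L p))"
  then obtain g where g: "smooth_on T g" and h: "h = (\<lambda>p. g (L p))" by blast
  have "(h has_derivative (\<lambda>v. dir_deriv (L v) g (L p))) (at p)" if "p \<in> S" for p
    unfolding h
    using has_derivative_compose[OF bounded_linear_imp_has_derivative[OF assms(3)]
        smooth_on_has_derivative[OF g \<open>open T\<close> assms(4)[OF that]]] .
  then show "\<exists>D. (\<forall>p\<in>S. (h has_derivative D p) (at p)) \<and>
      (\<exists>g. smooth_on T g \<and> (\<lambda>p. D p v) = (\<lambda>p. g (L p)))"
    using smooth_on_dir_deriv[OF g, of "L v"]
    by (intro exI[of _ "\<lambda>p v. dir_deriv (L v) g (L p)"] exI[of _ "dir_deriv (L v) g"]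
        conjI ballI refl)
qed (use assms in auto)

lemma smooth_on_Pair:
  assumes "open S" "smooth_on S f" "smooth_on S g"
  shows "smooth_on S (\<lambda>p. (f p, g p))"
proof (rule smooth_on_coinduct[where
      C = "\<lambda>h. \<exists>f g. smooth_on S f \<and> smooth_on S g \<and> h = (\<lambda>p. (f p, g p))"])
  fix h :: "'a \<Rightarrow> 'b \<times> 'c" and v
  assume "\<exists>f g. smooth_on S f \<and> smooth_on S g \<and> h = (\<lambda>p. (f p, g p))"
  then obtain f g where fg: "smooth_on S f" "smooth_on S g" and h: "h = (\<lambda>p. (f p, g p))" by blast
  have "(h has_derivative (\<lambda>v. (dir_deriv v f p, dir_deriv v g p))) (at p)" if "p \<in> S" for p
    unfolding h using fg that \<open>open S\<close> by (intro has_derivative_Pair smooth_on_has_derivative)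
  then show "\<exists>D. (\<forall>p\<in>S. (h has_derivative D p) (at p)) \<and>
      (\<exists>f g. smooth_on S f \<and> smooth_on S g \<and> (\<lambda>p. D p v) = (\<lambda>p. (f p, g p)))"
    using smooth_on_dir_deriv[OF fg(1), of v] smooth_on_dir_deriv[OF fg(2), of v]
    by (intro exI[of _ "\<lambda>p v. (dir_deriv v f p, dir_deriv v g p)"]
        exI[of _ "dir_deriv v f"] exI[of _ "dir_deriv v g"] conjI ballI refl)
qed (use assms in auto)

text \<open>The products of two smooth functions are not stable under differentiation, but their sums are;
  to apply coinduction the class is therefore closed under all the operations at once.  The last
  rule mentions \<open>k\<close> instead of \<open>\<lambda>p. h (f p)\<close> to keep unification in induction proofs
  first order.\<close>

inductive real_expr :: "'a::real_normed_vector set \<Rightarrow> ('a \<Rightarrow> real) \<Rightarrow> bool" for S where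
  base: "smooth_on S f \<Longrightarrow> real_expr S f"
| add: "real_expr S f \<Longrightarrow> real_expr S g \<Longrightarrow> real_expr S (\<lambda>p. f p + g p)"
| mult: "real_expr S f \<Longrightarrow> real_expr S g \<Longrightarrow> real_expr S (\<lambda>p. f p * g p)"
| comp: "open T \<Longrightarrow> smooth_on T (h :: real \<Rightarrow> real) \<Longrightarrow> smooth_on S f \<Longrightarrow> (\<And>p. p \<in> S \<Longrightarrow> f p \<in> T) \<Longrightarrow>
    k = (\<lambda>p. h (f p)) \<Longrightarrow> real_expr S k"

lemma smooth_on_real_expr:
  assumes "open S" "real_expr S f"
  shows "smooth_on S f"
proof (rule smooth_on_coinduct[where C = "real_expr S"])
  fix f :: "'a \<Rightarrow> real" and v
  assume "real_expr S f"
  then show "\<exists>D. (\<forall>p\<in>S. (f has_derivative D p) (at p)) \<and> real_expr S (\<lambda>p. D p v)"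
  proof induction
    case (base f)
    then show ?case
      by (intro exI[of _ "\<lambda>p v. dir_deriv v f p"] conjI ballI
          smooth_on_has_derivative[OF _ \<open>open S\<close>] real_expr.base[OF smooth_on_dir_deriv])
  next
    case (add f g)
    then obtain D E where "\<forall>p\<in>S. (f has_derivative D p) (at p)" "real_expr S (\<lambda>p. D p v)"
      "\<forall>p\<in>S. (g has_derivative E p) (at p)" "real_expr S (\<lambda>p. E p v)" by blast
    then have "\<forall>p\<in>S. ((\<lambda>p. f p + g p) has_derivative (\<lambda>v. D p v + E p v)) (at p)"
      "real_expr S (\<lambda>p. D p v + E p v)"
      by (blast intro: has_derivative_add, intro real_expr.add)
    then show ?case
      by (intro exI[of _ "\<lambda>p v. D p v + E p v"] conjI)
  next
    case (mult f g)
    then obtain D E where "\<forall>p\<in>S. (f has_derivative D p) (at p)" "real_expr S (\<lambda>p. D p v)"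
      "\<forall>p\<in>S. (g has_derivative E p) (at p)" "real_expr S (\<lambda>p. E p v)" by blast
    then have
      "\<forall>p\<in>S. ((\<lambda>p. f p * g p) has_derivative (\<lambda>v. f p * E p v + D p v * g p)) (at p)"
      "real_expr S (\<lambda>p. f p * E p v + D p v * g p)"
      using mult.hyps by (blast intro: has_derivative_mult, intro real_expr.add real_expr.mult)
    then show ?case
      by (intro exI[of _ "\<lambda>p v. f p * E p v + D p v * g p"] conjI)
  next
    case (comp T h f k)
    have *: "(k has_derivative (\<lambda>v. dir_deriv v f p * dir_deriv 1 h (f p))) (at p)"
      if "p \<in> S" for p
    proof -
      have h: "(h has_derivative (\<lambda>t. dir_deriv t h (f p))) (at (f p))"
        using smooth_on_has_derivative[OF comp.hyps(2,1) comp.hyps(4)[OF that]] .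
      have "(\<lambda>t. dir_deriv t h (f p)) = (\<lambda>t. t * dir_deriv 1 h (f p))"
        using linear_cmul[OF has_derivative_linear[OF h], of _ 1, unfolded real_scaleR_def mult_1_right]
        by (intro ext)
      with h have "(h has_derivative (\<lambda>t. t * dir_deriv 1 h (f p))) (at (f p))"
        by metis
      then show ?thesis
        unfolding comp.hyps(5) by (rule has_derivative_compose[OF
              smooth_on_has_derivative[OF comp.hyps(3) \<open>open S\<close> that]])
    qed
    have "real_expr S (\<lambda>p. dir_deriv v f p * dir_deriv 1 h (f p))"
      by (rule real_expr.mult[OF real_expr.base[OF smooth_on_dir_deriv[OF comp.hyps(3)]]
            real_expr.comp[OF comp.hyps(1) smooth_on_dir_deriv[OF comp.hyps(2)] comp.hyps(3,4) refl]])
    then show ?case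
      by (intro exI[of _ "\<lambda>p v. dir_deriv v f p * dir_deriv 1 h (f p)"] conjI ballI *)
  qed
qed (rule assms)+

lemma smooth_on_add:
  fixes f g :: "'a::real_normed_vector \<Rightarrow> real"
  shows "open S \<Longrightarrow> smooth_on S f \<Longrightarrow> smooth_on S g \<Longrightarrow> smooth_on S (\<lambda>p. f p + g p)"
  by (rule smooth_on_real_expr[OF _ real_expr.add[OF real_expr.base real_expr.base]])

lemma smooth_on_mult:
  fixes f g :: "'a::real_normed_vector \<Rightarrow> real"
  shows "open S \<Longrightarrow> smooth_on S f \<Longrightarrow> smooth_on S g \<Longrightarrow> smooth_on S (\<lambda>p. f p * g p)"
  by (rule smooth_on_real_expr[OF _ real_expr.mult[OF real_expr.base real_expr.base]])

lemma smooth_on_compose_real: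
  fixes f :: "'a::real_normed_vector \<Rightarrow> real" and h :: "real \<Rightarrow> real"
  shows "open S \<Longrightarrow> open T \<Longrightarrow> smooth_on T h \<Longrightarrow> smooth_on S f \<Longrightarrow> (\<And>p. p \<in> S \<Longrightarrow> f p \<in> T) \<Longrightarrow>
    smooth_on S (\<lambda>p. h (f p))"
  by (rule smooth_on_real_expr[OF _ real_expr.comp[of T h S f, OF _ _ _ _ refl]]) auto

lemma smooth_on_minus:
  fixes f :: "'a::real_normed_vector \<Rightarrow> real"
  shows "open S \<Longrightarrow> smooth_on S f \<Longrightarrow> smooth_on S (\<lambda>p. - f p)"
  using smooth_on_mult[OF _ smooth_on_const[of S "-1"]] by simp

lemma smooth_on_diff:
  fixes f g :: "'a::real_normed_vector \<Rightarrow> real"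
  shows "open S \<Longrightarrow> smooth_on S f \<Longrightarrow> smooth_on S g \<Longrightarrow> smooth_on S (\<lambda>p. f p - g p)"
  using smooth_on_add[OF _ _ smooth_on_minus] by fastforce

text \<open>Square roots and reciprocals are both powers, and the multiples of powers are stable under
  differentiation.\<close>

lemma smooth_on_powr: "smooth_on {0<..} (\<lambda>x::real. c * x powr a)"
proof (rule smooth_on_coinduct[where C = "\<lambda>f. \<exists>c a. f = (\<lambda>x. c * x powr a)"])
  fix f :: "real \<Rightarrow> real" and v
  assume "\<exists>c a. f = (\<lambda>x. c * x powr a)"
  then obtain c a where f: "f = (\<lambda>x. c * x powr a)" by blast
  have "(f has_derivative (\<lambda>v. (v * c * a) * x powr (a - 1))) (at x)" if "x \<in> {0<..}" for x
    unfolding f using that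
    by (auto intro!: derivative_eq_intros simp: powr_diff field_simps)
  then show "\<exists>D. (\<forall>x\<in>{0<..}. (f has_derivative D x) (at x)) \<and>
      (\<exists>c a. (\<lambda>x. D x v) = (\<lambda>x. c * x powr a))"
    by (intro exI[of _ "\<lambda>x v. (v * c * a) * x powr (a - 1)"]) blast
qed auto

lemma smooth_on_sqrt:
  fixes f :: "'a::real_normed_vector \<Rightarrow> real"
  assumes "open S" "smooth_on S f" "\<And>p. p \<in> S \<Longrightarrow> f p > 0"
  shows "smooth_on S (\<lambda>p. sqrt (f p))"
proof -
  have "smooth_on S (\<lambda>p. 1 * f p powr (1/2))"
    using assms by (intro smooth_on_compose_real[OF _ _ smooth_on_powr]) auto
  then show ?thesis
    using smooth_on_cong[OF assms(1), of "\<lambda>p. 1 * f p powr (1/2)" "\<lambda>p. sqrt (f p)"] assms(3)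
    by (simp add: powr_half_sqrt less_imp_le)
qed

lemma smooth_on_divide:
  fixes f h :: "'a::real_normed_vector \<Rightarrow> real"
  assumes "open S" "smooth_on S h" "smooth_on S f" "\<And>p. p \<in> S \<Longrightarrow> f p > 0"
  shows "smooth_on S (\<lambda>p. h p / f p)"
proof -
  have "smooth_on S (\<lambda>p. h p * (1 * f p powr -1))"
    using assms
    by (intro smooth_on_mult[OF _ _ smooth_on_compose_real[OF _ _ smooth_on_powr]]) auto
  then show ?thesis
    using smooth_on_cong[OF assms(1), of "\<lambda>p. h p * (1 * f p powr -1)" "\<lambda>p. h p / f p"] assms(4)
    by (simp add: powr_minus_divide less_imp_le)
qed

lemma smooth_on_arctan:
  "smooth_on UNIV arctan"
proof (rule smooth_on_coinduct[where C = "\<lambda>f. f = arctan \<or> smooth_on UNIV f"])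
  fix f :: "real \<Rightarrow> real" and v
  assume f: "f = arctan \<or> smooth_on UNIV f"
  have sm: "smooth_on UNIV (\<lambda>x::real. v / (1 + x * x))"
    by (intro smooth_on_divide smooth_on_add smooth_on_mult smooth_on_const smooth_on_ident)
      (auto simp: add_pos_nonneg)
  have der: "(arctan has_derivative (\<lambda>v. v / (1 + x * x))) (at x)" for x
    by (auto intro!: derivative_eq_intros simp: field_simps power2_eq_square)
  show "\<exists>D. (\<forall>p\<in>UNIV. (f has_derivative D p) (at p)) \<and>
      ((\<lambda>p. D p v) = arctan \<or> smooth_on UNIV (\<lambda>p. D p v))"
    using f
  proof
    assume "f = arctan"
    then show ?thesis
      using sm der by (intro exI[of _ "\<lambda>x v. v / (1 + x * x)"]) auto
  next
    assume "smooth_on UNIV f"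
    then show ?thesis
      using smooth_on_has_derivative[of UNIV f] smooth_on_dir_deriv[of UNIV f v]
      by (intro exI[of _ "\<lambda>p v. dir_deriv v f p"]) auto
  qed
qed auto

section \<open>Symmetry of second derivatives\<close>

lemma smooth_on_continuous_at:
  assumes "smooth_on S f" "open S" "p \<in> S"
  shows "isCont f p"
  using smooth_on_differentiable[OF assms] differentiable_imp_continuous_within by blast

lemma smooth_on_line_derivative:
  fixes f :: "'a::real_normed_vector \<Rightarrow> real"
  assumes "smooth_on S f" "open S" "p + t *\<^sub>R v \<in> S"
  shows "((\<lambda>t. f (p + t *\<^sub>R v)) has_real_derivative dir_deriv v f (p + t *\<^sub>R v)) (at t)"
proof -
  have "((\<lambda>t. p + t *\<^sub>R v) has_derivative (\<lambda>t. t *\<^sub>R v)) (at t)"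
    by (auto intro!: derivative_eq_intros)
  then have "((\<lambda>t. f (p + t *\<^sub>R v)) has_derivative (\<lambda>s. dir_deriv (s *\<^sub>R v) f (p + t *\<^sub>R v))) (at t)"
    by (rule has_derivative_compose[where g = f and f = "\<lambda>t. p + t *\<^sub>R v", OF _ smooth_on_has_derivative[OF assms]])
  then show ?thesis
    unfolding has_field_derivative_def
      linear_cmul[OF linear_dir_deriv[OF smooth_on_differentiable[OF assms]]] real_scaleR_def
    by (simp only: mult.commute[of _ "dir_deriv v f (p + t *\<^sub>R v)"])
qed

text \<open>The mean value theorem, first along \<open>x\<close> for the difference of \<open>f\<close> in direction \<open>y\<close> and then along
  \<open>y\<close> for the derivative of \<open>f\<close> in direction \<open>x\<close>.\<close>

lemma second_difference_mean_value:
  fixes f :: "'a::real_normed_vector \<Rightarrow> real"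
  assumes "smooth_on S f" "open S" "h > 0"
    and sub: "\<And>a b. 0 \<le> a \<Longrightarrow> a \<le> h \<Longrightarrow> 0 \<le> b \<Longrightarrow> b \<le> h \<Longrightarrow> p + a *\<^sub>R x + b *\<^sub>R y \<in> S"
  shows "\<exists>a b. 0 \<le> a \<and> a \<le> h \<and> 0 \<le> b \<and> b \<le> h \<and>
    f (p + h *\<^sub>R x + h *\<^sub>R y) - f (p + h *\<^sub>R x) - f (p + h *\<^sub>R y) + f p
      = h * h * dir_deriv y (dir_deriv x f) (p + a *\<^sub>R x + b *\<^sub>R y)"
proof -
  define G where "G a = f (p + h *\<^sub>R y + a *\<^sub>R x) - f (p + a *\<^sub>R x)" for a
  have G: "(G has_real_derivative
      dir_deriv x f (p + h *\<^sub>R y + a *\<^sub>R x) - dir_deriv x f (p + a *\<^sub>R x)) (at a)"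
    if "0 \<le> a" "a \<le> h" for a
    unfolding G_def using sub[OF that, of h] sub[OF that, of 0] \<open>h > 0\<close>
    by (intro DERIV_diff smooth_on_line_derivative[OF assms(1,2), where v = x])
      (auto simp: algebra_simps)
  obtain a where a: "0 < a" "a < h" "G h - G 0 = (h - 0) *
      (dir_deriv x f (p + h *\<^sub>R y + a *\<^sub>R x) - dir_deriv x f (p + a *\<^sub>R x))"
    using MVT2[OF \<open>h > 0\<close> G] by blast
  have H: "((\<lambda>b. dir_deriv x f (p + a *\<^sub>R x + b *\<^sub>R y)) has_real_derivative
      dir_deriv y (dir_deriv x f) (p + a *\<^sub>R x + b *\<^sub>R y)) (at b)" if "0 \<le> b" "b \<le> h" for b
    using sub[of a b] a that
    by (intro smooth_on_line_derivative[OF smooth_on_dir_deriv[OF assms(1)] assms(2),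
          where v1 = x and v = y]) auto
  obtain b where "0 < b" "b < h" "dir_deriv x f (p + a *\<^sub>R x + h *\<^sub>R y)
      - dir_deriv x f (p + a *\<^sub>R x + 0 *\<^sub>R y) =
      (h - 0) * dir_deriv y (dir_deriv x f) (p + a *\<^sub>R x + b *\<^sub>R y)"
    using MVT2[OF \<open>h > 0\<close> H] by blast
  then show ?thesis
    using a by (intro exI[of _ a] exI[of _ b]) (auto simp: G_def algebra_simps)
qed

text \<open>The second difference of \<open>f\<close> over a parallelogram is symmetric in its two sides.  By the mean
  value theorem it is the area times a value of either mixed derivative, and for small
  parallelograms these values come arbitrarily close to those at \<open>p\<close>.\<close>

lemma dir_deriv_commute:
  fixes f :: "'a::real_normed_vector \<Rightarrow> real"
  assumes sm: "smooth_on S f" and "open S" "p \<in> S"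
  shows "dir_deriv y (dir_deriv x f) p = dir_deriv x (dir_deriv y f) p"
proof (rule ccontr)
  define A where "A = dir_deriv y (dir_deriv x f)"
  define B where "B = dir_deriv x (dir_deriv y f)"
  assume "dir_deriv y (dir_deriv x f) p \<noteq> dir_deriv x (dir_deriv y f) p"
  then have "\<bar>A p - B p\<bar> / 2 > 0" (is "?e > 0")
    by (simp add: A_def B_def)
  have "isCont A p" "isCont B p"
    unfolding A_def B_def
    using smooth_on_continuous_at[OF _ \<open>open S\<close> \<open>p \<in> S\<close>] smooth_on_dir_deriv sm by blast+
  then obtain d1 d2 where d: "d1 > 0" "\<And>q. dist q p < d1 \<Longrightarrow> dist (A q) (A p) < ?e"
    "d2 > 0" "\<And>q. dist q p < d2 \<Longrightarrow> dist (B q) (B p) < ?e"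
    using \<open>?e > 0\<close> unfolding continuous_at_eps_delta by metis
  obtain d3 where d3: "d3 > 0" "ball p d3 \<subseteq> S"
    using \<open>open S\<close> \<open>p \<in> S\<close> openE by blast
  define d where "d = min d1 (min d2 d3)"
  define h where "h = d / (2 * (norm x + norm y + 1))"
  have "d > 0"
    using d d3 by (simp add: d_def)
  have "norm x + norm y + 1 > 0"
    by (smt (verit) norm_ge_zero)
  then have "h > 0"
    using \<open>d > 0\<close> by (simp add: h_def)
  have close: "dist (p + a *\<^sub>R x + b *\<^sub>R y) p < d"
    if "0 \<le> a" "a \<le> h" "0 \<le> b" "b \<le> h" for a b
  proof -
    have "dist (p + a *\<^sub>R x + b *\<^sub>R y) p = norm (a *\<^sub>R x + b *\<^sub>R y)"
      by (simp add: dist_norm algebra_simps)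
    also have "\<dots> \<le> a * norm x + b * norm y"
      using that norm_triangle_ineq[of "a *\<^sub>R x" "b *\<^sub>R y"] by simp
    also have "\<dots> \<le> h * norm x + h * norm y"
      using that by (intro add_mono mult_right_mono) auto
    also have "\<dots> \<le> h * (norm x + norm y + 1)"
      using \<open>h > 0\<close> by (simp add: algebra_simps)
    also have "\<dots> = d / 2"
      using \<open>norm x + norm y + 1 > 0\<close> by (simp add: h_def divide_simps)
    finally show ?thesis
      using \<open>d > 0\<close> by simp
  qed
  have sub: "p + a *\<^sub>R x + b *\<^sub>R y \<in> S" if "0 \<le> a" "a \<le> h" "0 \<le> b" "b \<le> h" for a b
    using close[OF that] d3 by (auto simp: d_def dist_commute)
  have sub': "p + b *\<^sub>R y + a *\<^sub>R x \<in> S" if "0 \<le> b" "b \<le> h" "0 \<le> a" "a \<le> h" for a b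
    using sub[of a b] that by (simp add: algebra_simps)
  obtain a b where ab: "0 \<le> a" "a \<le> h" "0 \<le> b" "b \<le> h"
    "f (p + h *\<^sub>R x + h *\<^sub>R y) - f (p + h *\<^sub>R x) - f (p + h *\<^sub>R y) + f p
      = h * h * A (p + a *\<^sub>R x + b *\<^sub>R y)"
    using second_difference_mean_value[OF sm \<open>open S\<close> \<open>h > 0\<close> sub] unfolding A_def by blast
  obtain b' a' where ab': "0 \<le> a'" "a' \<le> h" "0 \<le> b'" "b' \<le> h"
    "f (p + h *\<^sub>R y + h *\<^sub>R x) - f (p + h *\<^sub>R y) - f (p + h *\<^sub>R x) + f p
      = h * h * B (p + b' *\<^sub>R y + a' *\<^sub>R x)"
    using second_difference_mean_value[OF sm \<open>open S\<close> \<open>h > 0\<close> sub'] unfolding B_def by blast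
  have "h * h * A (p + a *\<^sub>R x + b *\<^sub>R y) = h * h * B (p + a' *\<^sub>R x + b' *\<^sub>R y)"
    using ab(5) ab'(5) by (simp add: algebra_simps)
  then have "A (p + a *\<^sub>R x + b *\<^sub>R y) = B (p + a' *\<^sub>R x + b' *\<^sub>R y)"
    using \<open>h > 0\<close> by simp
  moreover have "dist (A (p + a *\<^sub>R x + b *\<^sub>R y)) (A p) < ?e"
    using close[OF ab(1-4)] d by (simp add: d_def)
  moreover have "dist (B (p + a' *\<^sub>R x + b' *\<^sub>R y)) (B p) < ?e"
    using close[OF ab'(1-4)] d by (simp add: d_def)
  ultimately show False
    by (simp add: dist_real_def) (smt (verit) field_sum_of_halves)
qed

section \<open>The hypersurface and its adapted coframe\<close>

lemma has_derivative_complex_split: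
  assumes "(G has_derivative G') (at z)"
  shows "G' v = Re v *\<^sub>R G' 1 + Im v *\<^sub>R G' \<i>"
proof -
  have "v = Re v *\<^sub>R 1 + Im v *\<^sub>R \<i>"
    by (simp add: complex_eq_iff)
  then show ?thesis
    using has_derivative_linear[OF assms] by (metis linear_add linear_cmul)
qed

locale kaehler_potential =
  fixes U :: "complex set" and F :: "complex \<Rightarrow> real"
  assumes open_U: "open U" and smooth_F: "smooth_on U F"
    and F_zzbar_pos: "\<And>z. z \<in> U \<Longrightarrow> F_zzbar F z > 0"
begin

abbreviation "f \<equiv> F_zzbar F"

definition "F1 = dir_deriv 1 F"
definition "F2 = dir_deriv \<i> F"

lemma smooth_F1: "smooth_on U F1" and smooth_F2: "smooth_on U F2"
  unfolding F1_def F2_def by (rule smooth_on_dir_deriv[OF smooth_F])+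

lemmas deriv_F = smooth_on_has_derivative[OF smooth_F open_U]
lemmas deriv_F1 = smooth_on_has_derivative[OF smooth_F1 open_U]
lemmas deriv_F2 = smooth_on_has_derivative[OF smooth_F2 open_U]

lemma dir_deriv_F: "z \<in> U \<Longrightarrow> dir_deriv v F z = F1 z * Re v + F2 z * Im v"
  using has_derivative_complex_split[OF deriv_F, of z v] by (simp add: F1_def F2_def)

lemma f_eq:
  assumes "z \<in> U"
  shows "f z = (dir_deriv 1 F1 z + dir_deriv \<i> F2 z) / 4"
proof -
  have "d_z (\<lambda>q. complex_of_real (F q)) q = Complex (F1 q / 2) (- F2 q / 2)" if "q \<in> U" for q
  proof -
    have "((\<lambda>q. complex_of_real (F q)) has_derivative (\<lambda>v. complex_of_real (dir_deriv v F q))) (at q)"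
      using deriv_F[OF that] by (rule has_derivative_of_real)
    then show ?thesis
      unfolding d_z_def by (simp add: dir_deriv_eqI[where p = q] F1_def F2_def complex_eq_iff)
  qed
  then have *: "dir_deriv v (d_z (\<lambda>q. complex_of_real (F q))) z =
      dir_deriv v (\<lambda>q. complex_of_real (F1 q) / 2 - \<i> * complex_of_real (F2 q) / 2) z" for v
    by (intro dir_deriv_cong_open[OF open_U assms]) (simp add: complex_eq_iff)
  have "((\<lambda>q. complex_of_real (F1 q) / 2 - \<i> * complex_of_real (F2 q) / 2) has_derivative
     (\<lambda>v. complex_of_real (dir_deriv v F1 z) / 2 - \<i> * complex_of_real (dir_deriv v F2 z) / 2)) (at z)"
    using deriv_F1[OF assms] deriv_F2[OF assms]
    by (auto intro!: derivative_eq_intros)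
  then show ?thesis
    unfolding F_zzbar_def d_zbar_def * by (simp add: dir_deriv_eqI[where p = z])
qed

lemma smooth_f: "smooth_on U f"
proof -
  have "smooth_on U (\<lambda>z. (dir_deriv 1 F1 z + dir_deriv \<i> F2 z) / 4)"
    by (intro smooth_on_divide smooth_on_add smooth_on_const smooth_on_dir_deriv
        smooth_F1 smooth_F2 open_U) simp
  then show ?thesis
    using smooth_on_cong[OF open_U f_eq] by simp
qed

lemmas deriv_f = smooth_on_has_derivative[OF smooth_f open_U]

text \<open>The contact form \<open>du - \<i> F\<^sub>z dz + \<i> F\<^sub>z\<^sub>b\<^sub>a\<^sub>r dzbar\<close>, whose kernel is \<open>D\<close>.\<close>

definition alpha :: "complex \<Rightarrow> complex \<times> real \<Rightarrow> real"
  where "alpha z v = snd v + F1 z * Im (fst v) - F2 z * Re (fst v)"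

lemma hyp_param_derivative:
  assumes "fst p \<in> U"
  shows "frechet_derivative (hyp_param F) (at p) =
    (\<lambda>v. (fst v, Complex (snd v) (dir_deriv (fst v) F (fst p))))"
proof -
  have eq: "hyp_param F = (\<lambda>p. (fst p, complex_of_real (snd p) + \<i> * complex_of_real (F (fst p))))"
    by (auto simp: hyp_param_def complex_eq_iff)
  have "((\<lambda>p. F (fst p)) has_derivative (\<lambda>v. dir_deriv (fst v) F (fst p))) (at p)"
    by (rule has_derivative_compose[where g = F and f = fst, OF _ deriv_F[OF assms]])
      (auto intro!: derivative_eq_intros)
  then have "(hyp_param F has_derivative
      (\<lambda>v. (fst v, complex_of_real (snd v) + \<i> * complex_of_real (dir_deriv (fst v) F (fst p))))) (at p)"
    unfolding eq by (auto intro!: derivative_eq_intros)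
  then have "frechet_derivative (hyp_param F) (at p) =
      (\<lambda>v. (fst v, complex_of_real (snd v) + \<i> * complex_of_real (dir_deriv (fst v) F (fst p))))"
    by (rule frechet_derivative_at[symmetric])
  then show ?thesis
    by (simp add: fun_eq_iff complex_eq_iff)
qed

text \<open>If the contact form vanishes on \<open>v\<close>, the witness for \<open>v \<in> \<i> TM\<close> is \<open>- J v\<close>.\<close>

lemma mem_hyp_D:
  assumes "fst p \<in> U" "alpha (fst p) v = 0"
  shows "v \<in> hyp_D F p"
proof -
  have "snd v = F2 (fst p) * Re (fst v) - F1 (fst p) * Im (fst v)"
    using assms(2) by (simp add: alpha_def)
  then have "frechet_derivative (hyp_param F) (at p) v =
      mult_i (frechet_derivative (hyp_param F) (at p) (- \<i> * fst v, dir_deriv (fst v) F (fst p)))"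
    unfolding hyp_param_derivative[OF assms(1)]
    by (simp add: mult_i_def dir_deriv_F[OF assms(1)] complex_eq_iff)
  then show ?thesis
    unfolding hyp_D_def hyp_tangent_def by auto
qed

lemma hyp_J_eq:
  assumes "fst p \<in> U" "alpha (fst p) v = 0"
  shows "hyp_J F p v = (\<i> * fst v, - dir_deriv (fst v) F (fst p))"
proof -
  have v: "snd v = F2 (fst p) * Re (fst v) - F1 (fst p) * Im (fst v)"
    using assms(2) by (simp add: alpha_def)
  show ?thesis
    unfolding hyp_J_def
  proof (rule the_equality)
    show "frechet_derivative (hyp_param F) (at p) (\<i> * fst v, - dir_deriv (fst v) F (fst p)) =
        mult_i (frechet_derivative (hyp_param F) (at p) v)"
      unfolding hyp_param_derivative[OF assms(1)]
      by (simp add: mult_i_def v dir_deriv_F[OF assms(1)] complex_eq_iff)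
  next
    fix v'
    assume "frechet_derivative (hyp_param F) (at p) v' =
        mult_i (frechet_derivative (hyp_param F) (at p) v)"
    then show "v' = (\<i> * fst v, - dir_deriv (fst v) F (fst p))"
      unfolding hyp_param_derivative[OF assms(1)]
      by (simp add: mult_i_def complex_eq_iff prod_eq_iff)
  qed
qed

text \<open>The horizontal lift of \<open>\<partial>\<^sub>x/2\<close>, so that \<open>X - \<i> J X\<close> is the horizontal lift
  \<open>\<partial>\<^sub>z + \<i> F\<^sub>z \<partial>\<^sub>u\<close> of \<open>\<partial>\<^sub>z\<close>.\<close>

definition X :: "complex \<times> real \<Rightarrow> complex \<times> real"
  where "X p = (1 / 2, F2 (fst p) / 2)"

lemma J_X: "fst p \<in> U \<Longrightarrow> hyp_J F p (X p) = (\<i> / 2, - F1 (fst p) / 2)"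
  by (subst hyp_J_eq) (simp_all add: X_def alpha_def dir_deriv_F)

lemma deriv_X:
  assumes "fst p \<in> U"
  shows "(X has_derivative (\<lambda>v. (0, dir_deriv (fst v) F2 (fst p) / 2))) (at p)"
proof -
  have "((\<lambda>p. F2 (fst p)) has_derivative (\<lambda>v. dir_deriv (fst v) F2 (fst p))) (at p)"
    by (rule has_derivative_compose[where g = F2 and f = fst, OF _ deriv_F2[OF assms]])
      (auto intro!: derivative_eq_intros)
  then show ?thesis
    unfolding X_def by (auto intro!: derivative_eq_intros)
qed

lemma deriv_J_X:
  assumes "fst p \<in> U"
  shows "((\<lambda>q. hyp_J F q (X q)) has_derivative (\<lambda>v. (0, - dir_deriv (fst v) F1 (fst p) / 2))) (at p)"
proof -
  have "((\<lambda>p. F1 (fst p)) has_derivative (\<lambda>v. dir_deriv (fst v) F1 (fst p))) (at p)"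
    by (rule has_derivative_compose[where g = F1 and f = fst, OF _ deriv_F1[OF assms]])
      (auto intro!: derivative_eq_intros)
  then have "((\<lambda>p. (\<i> / 2, - F1 (fst p) / 2)) has_derivative
      (\<lambda>v. (0::complex, - dir_deriv (fst v) F1 (fst p) / 2))) (at p)"
    by (auto intro!: derivative_eq_intros)
  then show ?thesis
    using has_derivative_cong_open[of "U \<times> UNIV" p "\<lambda>q. hyp_J F q (X q)"] J_X assms open_U
    by (auto simp: open_Times mem_Times_iff)
qed

text \<open>With \<open>Y = J X\<close> the real part of \<open>[X - \<i> Y, X + \<i> Y]\<close> vanishes and the imaginary part is
  \<open>2 [X, Y] = - 2 f \<partial>\<^sub>u\<close>.\<close>

lemma adapted_del_o_X:
  assumes "fst p \<in> U"
  shows "adapted_del_o (hyp_J F) X p = ((0, 2 * f (fst p)), 0)"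
proof -
  let ?Y = "\<lambda>q. hyp_J F q (X q)"
  note X = dir_deriv_eqI[OF deriv_X[OF assms]] and Y = dir_deriv_eqI[OF deriv_J_X[OF assms]]
    and mY = dir_deriv_eqI[OF has_derivative_minus[OF deriv_J_X[OF assms]]]
  have scale: "dir_deriv (1/2) G (fst p) = dir_deriv 1 G (fst p) / 2"
    "dir_deriv (\<i>/2) G (fst p) = dir_deriv \<i> G (fst p) / 2"
    "dir_deriv (-\<i>/2) G (fst p) = - dir_deriv \<i> G (fst p) / 2"
    if "smooth_on U G" for G :: "complex \<Rightarrow> real"
    using has_derivative_complex_split[OF smooth_on_has_derivative[OF that open_U assms], of "1/2"]
      has_derivative_complex_split[OF smooth_on_has_derivative[OF that open_U assms], of "\<i>/2"]
      has_derivative_complex_split[OF smooth_on_has_derivative[OF that open_U assms], of "-\<i>/2"]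
    by simp_all
  have "lie_bracket X ?Y p = (0, - f (fst p))"
    using scale[OF smooth_F1] scale[OF smooth_F2]
    by (simp add: lie_bracket_def X Y J_X[OF assms] f_eq[OF assms])
      (simp add: X_def field_simps)
  moreover have "lie_bracket (\<lambda>q. - ?Y q) X p = (0, - f (fst p))"
    using scale[OF smooth_F1] scale[OF smooth_F2]
    by (simp add: lie_bracket_def X mY J_X[OF assms] f_eq[OF assms])
      (simp add: X_def field_simps)
  moreover have "lie_bracket (\<lambda>q. - ?Y q) ?Y p = 0"
    using scale[OF smooth_F1]
    by (simp add: lie_bracket_def Y mY J_X[OF assms] zero_prod_def)
  ultimately show ?thesis
    by (simp add: adapted_del_o_def adapted_del_def cx_times_i_def cx_lie_bracket_def cx_conj_def
        comp_def) (simp add: lie_bracket_def)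
qed

definition mu :: "complex \<times> real \<Rightarrow> complex \<times> real \<Rightarrow> complex"
  where "mu p v = fst v"

definition lam :: "complex \<times> real \<Rightarrow> complex \<times> real \<Rightarrow> real"
  where "lam p v = alpha (fst p) v / (2 * f (fst p))"

lemma adapted_coframe_mu_lam: "adapted_coframe (U \<times> UNIV) (hyp_D F) (hyp_J F) mu lam"
  unfolding adapted_coframe_def
proof (intro exI[of _ X] conjI ballI)
  have "smooth_on (U \<times> UNIV) (\<lambda>p. F2 (fst p))"
    by (rule smooth_on_o_linear[OF _ open_U bounded_linear_fst _ smooth_F2])
      (auto simp: open_Times open_U)
  then have "smooth_on (U \<times> UNIV) X"
    unfolding X_def by (intro smooth_on_Pair smooth_on_divide smooth_on_const) (auto simp: open_Times open_U)
  then show "nonvanishing_section (U \<times> UNIV) (hyp_D F) X"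
    by (auto simp: nonvanishing_section_def X_def alpha_def zero_prod_def intro!: mem_hyp_D)
next
  fix p :: "complex \<times> real" assume "p \<in> U \<times> UNIV"
  then have p: "fst p \<in> U" by auto
  show "linear (mu p)" "linear (lam p)"
    by (auto simp: linear_iff mu_def lam_def alpha_def algebra_simps add_divide_distrib
        diff_divide_distrib)
  note defs = cx_ext_def adapted_del_def cx_conj_def J_X[OF p] adapted_del_o_X[OF p]
  show "cx_ext (mu p) (adapted_del (hyp_J F) X p) = 1"
    "cx_ext (mu p) (cx_conj (adapted_del (hyp_J F) X p)) = 0"
    "cx_ext (mu p) (adapted_del_o (hyp_J F) X p) = 0"
    by (simp_all add: defs mu_def) (simp_all add: X_def)
  show "cx_ext (\<lambda>v. complex_of_real (lam p v)) (adapted_del (hyp_J F) X p) = 0"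
    "cx_ext (\<lambda>v. complex_of_real (lam p v)) (cx_conj (adapted_del (hyp_J F) X p)) = 0"
    "cx_ext (\<lambda>v. complex_of_real (lam p v)) (adapted_del_o (hyp_J F) X p) = 1"
    using F_zzbar_pos[OF p] by (simp_all add: defs lam_def alpha_def) (simp_all add: X_def)
qed

end

section \<open>The curvature of the Kaehler metric\<close>

lemma sharp_eqI:
  assumes "\<And>v. b w v = \<beta> v" "\<And>w'. (\<And>v. b w' v = b w v) \<Longrightarrow> w' = w"
  shows "sharp b \<beta> = w"
  unfolding sharp_def by (rule the_equality) (use assms in auto)

context kaehler_potential
begin

text \<open>\<open>psi = \<partial>\<^sub>z log f\<close> is the only Christoffel symbol of the Kaehler metric, up to conjugation.\<close>

definition psi :: "complex \<Rightarrow> complex"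
  where "psi z = Complex (dir_deriv 1 f z / (2 * f z)) (- dir_deriv \<i> f z / (2 * f z))"

lemma dir_deriv_f:
  assumes "z \<in> U"
  shows "dir_deriv x f z = 2 * f z * Re (psi z * x)"
  using F_zzbar_pos[OF assms] has_derivative_complex_split[OF deriv_f[OF assms], of x]
  by (simp add: psi_def field_simps)

definition dpsi :: "complex \<Rightarrow> complex \<Rightarrow> complex"
  where "dpsi z x = dir_deriv x psi z"

lemma deriv_psi:
  assumes "z \<in> U"
  shows "(psi has_derivative dpsi z) (at z)"
proof -
  have pos: "\<And>z. z \<in> U \<Longrightarrow> 0 < 2 * f z"
    using F_zzbar_pos by simp
  have "smooth_on U (\<lambda>z. dir_deriv 1 f z / (2 * f z))"
    "smooth_on U (\<lambda>z. - dir_deriv \<i> f z / (2 * f z))"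
    by (intro smooth_on_divide smooth_on_minus smooth_on_mult smooth_on_const smooth_f
        smooth_on_dir_deriv open_U pos; assumption)+
  then have "(\<lambda>z. complex_of_real (dir_deriv 1 f z / (2 * f z)) +
      \<i> * complex_of_real (- dir_deriv \<i> f z / (2 * f z))) differentiable at z"
    using smooth_on_has_derivative[OF _ open_U assms]
    by (intro differentiable_add differentiable_mult differentiable_const
        differentiableI[OF has_derivative_of_real]) auto
  also have "(\<lambda>z. complex_of_real (dir_deriv 1 f z / (2 * f z)) +
      \<i> * complex_of_real (- dir_deriv \<i> f z / (2 * f z))) = psi"
    by (auto simp: psi_def complex_eq_iff fun_eq_iff)
  finally show ?thesis
    unfolding dpsi_def by (rule has_derivative_dir_deriv)
qed

lemma kaehler_metric_eq: "kaehler_metric F z v w = 2 * f z * Re (v * cnj w)"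
  by (simp add: kaehler_metric_def sym_prod_def)

lemma dir_deriv_kaehler_metric:
  assumes "z \<in> U"
  shows "dir_deriv x (\<lambda>z. kaehler_metric F z v w) z = 4 * f z * Re (psi z * x) * Re (v * cnj w)"
proof -
  have "((\<lambda>z. kaehler_metric F z v w) has_derivative (\<lambda>x. 2 * dir_deriv x f z * Re (v * cnj w))) (at z)"
    unfolding kaehler_metric_eq using deriv_f[OF assms] by (auto intro!: derivative_eq_intros)
  from dir_deriv_eqI[OF this, of x] show ?thesis
    by (simp only: dir_deriv_f[OF assms])
qed

lemma levi_civita_kaehler:
  assumes "z \<in> U"
  shows "levi_civita (kaehler_metric F) z x y = psi z * x * y"
  unfolding levi_civita_def
proof (rule sharp_eqI)
  fix v
  show "kaehler_metric F z (psi z * x * y) v =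
    (dir_deriv x (\<lambda>q. kaehler_metric F q y v) z + dir_deriv y (\<lambda>q. kaehler_metric F q x v) z
      - dir_deriv v (\<lambda>q. kaehler_metric F q x y) z) / 2"
    unfolding dir_deriv_kaehler_metric[OF assms] unfolding kaehler_metric_eq
    by (simp add: algebra_simps)
next
  fix w'
  assume "\<And>v. kaehler_metric F z w' v = kaehler_metric F z (psi z * x * y) v"
  from this[of 1] this[of \<i>] show "w' = psi z * x * y"
    using F_zzbar_pos[OF assms] by (simp add: kaehler_metric_eq complex_eq_iff)
qed

lemma riemann_kaehler:
  assumes "z \<in> U"
  shows "riemann (kaehler_metric F) z x y v = (dpsi z x * y - dpsi z y * x) * v"
proof -
  have "dir_deriv x (\<lambda>q. levi_civita (kaehler_metric F) q y v) z = dpsi z x * y * v" for x y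
  proof -
    have "((\<lambda>q. psi q * y * v) has_derivative (\<lambda>x. dpsi z x * y * v)) (at z)"
      using deriv_psi[OF assms] by (auto intro!: derivative_eq_intros)
    moreover have "dir_deriv x (\<lambda>q. levi_civita (kaehler_metric F) q y v) z =
        dir_deriv x (\<lambda>q. psi q * y * v) z"
      by (rule dir_deriv_cong_open[OF open_U assms levi_civita_kaehler])
    ultimately show ?thesis
      by (simp add: dir_deriv_eqI)
  qed
  then show ?thesis
    by (simp add: riemann_def levi_civita_kaehler[OF assms] algebra_simps)
qed

end

locale kaehler_einstein = kaehler_potential +
  fixes k :: real
  assumes einstein: "einstein_on U (kaehler_metric F) k"
begin

text \<open>The Ricci tensor of the Kaehler metric depends on the derivative of \<open>psi\<close> only through
  \<open>\<partial>\<^sub>z\<^sub>b\<^sub>a\<^sub>r psi\<close>, so the Einstein equation determines this number to be \<open>- k f\<close>; the value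
  \<open>dpsi z 1\<close> remains free.\<close>

lemma dpsi_eq:
  assumes "z \<in> U"
  shows "dpsi z x = dpsi z 1 * x + 2 * \<i> * complex_of_real (k * f z * Im x)"
proof -
  note dpsi = has_derivative_complex_split[OF deriv_psi[OF assms]]
  have ric: "ricci (kaehler_metric F) z y v = k * kaehler_metric F z y v" for y v
    using einstein assms by (simp add: einstein_on_def)
  have "ricci (kaehler_metric F) z 1 v = Im ((dpsi z \<i> - \<i> * dpsi z 1) * v)" for v
    unfolding ricci_def Basis_complex_def riemann_kaehler[OF assms]
    by (simp add: inner_complex_def algebra_simps)
  then have "Im ((dpsi z \<i> - \<i> * dpsi z 1) * v) = 2 * k * f z * Re v" for v
    using ric[of 1 v] by (simp add: kaehler_metric_eq)
  from this[of 1] this[of \<i>] have "dpsi z \<i> = \<i> * dpsi z 1 + 2 * \<i> * complex_of_real (k * f z)"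
    by (simp add: complex_eq_iff)
  then show ?thesis
    using dpsi[of x] by (simp add: complex_eq_iff algebra_simps)
qed

text \<open>The free part of the derivative of \<open>psi\<close> is complex linear and drops out of the commutator,
  which is the form in which the derivative enters the curvature.\<close>

lemma dpsi_commutator:
  assumes "z \<in> U"
  shows "dpsi z x * y - dpsi z y * x = - \<i> * complex_of_real (2 * k * f z * Im (cnj x * y))"
  by (simp add: dpsi_eq[OF assms, of x] dpsi_eq[OF assms, of y] complex_eq_iff algebra_simps)

end

section \<open>The lifted metric and its Levi-Civita connection\<close>

text \<open>The function \<open>B\<close> stays arbitrary until the Ricci tensor is known; \<open>B1\<close> and \<open>B2\<close> are its
  derivatives.  A point of the lift is \<open>((z, u), s)\<close>, and its fibre coordinate \<open>s\<close> is not the function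
  \<open>r\<close> of the lift: \<open>s\<close> makes all coefficients rational and runs through the whole line.\<close>

locale sasakian_lift = kaehler_einstein +
  fixes c :: real and B B1 B2 :: "real \<Rightarrow> real"
  assumes c_pos: "c > 0"
    and deriv_B: "\<And>s. (B has_real_derivative B1 s) (at s)"
    and deriv_B1: "\<And>s. (B1 has_real_derivative B2 s) (at s)"
begin

abbreviation hz :: "(complex \<times> real) \<times> real \<Rightarrow> complex"
  where "hz v \<equiv> fst (fst v)"

abbreviation al :: "(complex \<times> real) \<times> real \<Rightarrow> (complex \<times> real) \<times> real \<Rightarrow> real"
  where "al q v \<equiv> alpha (hz q) (fst v)"

definition phi :: "real \<Rightarrow> real"
  where "phi s = 1 + s\<^sup>2"

text \<open>The Kaehler metric, and its Kaehler form \<open>h(\<i> x, y)\<close>.\<close>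

definition hm :: "complex \<Rightarrow> complex \<Rightarrow> complex \<Rightarrow> real"
  where "hm z x y = 2 * f z * Re (cnj x * y)"

definition om :: "complex \<Rightarrow> complex \<Rightarrow> complex \<Rightarrow> real"
  where "om z x y = 2 * f z * Im (cnj x * y)"

definition G :: "(complex \<times> real) \<times> real \<Rightarrow> (complex \<times> real) \<times> real \<Rightarrow> (complex \<times> real) \<times> real \<Rightarrow> real"
  where "G q v w = c * (phi (snd q) * hm (hz q) (hz v) (hz w)
    + al q v * snd w + al q w * snd v + B (snd q) * al q v * al q w)"

text \<open>Vectors are built from these components and not from their coordinates, because only the
  components of the curvature are free of the first derivatives of \<open>F\<close>.\<close>

definition mk :: "(complex \<times> real) \<times> real \<Rightarrow> complex \<Rightarrow> real \<Rightarrow> real \<Rightarrow> (complex \<times> real) \<times> real"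
  where "mk q x a p = ((x, a - F1 (hz q) * Im x + F2 (hz q) * Re x), p)"

lemma mk_simps [simp]: "hz (mk q x a p) = x" "al q (mk q x a p) = a" "snd (mk q x a p) = p"
  by (simp_all add: mk_def alpha_def)

lemma mk_components: "v = mk q (hz v) (al q v) (snd v)"
  by (simp add: mk_def alpha_def prod_eq_iff)

lemma mk_add: "mk q x a p + mk q x' a' p' = mk q (x + x') (a + a') (p + p')"
  and mk_diff: "mk q x a p - mk q x' a' p' = mk q (x - x') (a - a') (p - p')"
  and mk_scale: "t *\<^sub>R mk q x a p = mk q (t *\<^sub>R x) (t * a) (t * p)"
  by (simp_all add: mk_def algebra_simps)

lemma eq_mk_iff: "v = mk q x a p \<longleftrightarrow> hz v = x \<and> al q v = a \<and> snd v = p"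
  using mk_components[of v q] mk_simps by metis

lemma phi_pos: "phi s > 0"
  by (simp add: phi_def add_pos_nonneg)

text \<open>Testing with \<open>\<partial>\<^sub>s\<close> detects the contact component, after that \<open>\<partial>\<^sub>u\<close> the fibre component, and
  horizontal vectors the rest.\<close>

lemma G_nondegenerate:
  assumes "hz q \<in> U" "\<And>v. G q w' v = G q w v"
  shows "w' = w"
proof -
  have "al q w' = al q w"
    using assms(2)[of "mk q 0 0 1"] c_pos by (simp add: G_def hm_def)
  moreover have "snd w' = snd w"
    using assms(2)[of "mk q 0 1 0"] c_pos calculation by (simp add: G_def hm_def)
  moreover have "hz w' = hz w"
    using assms(2)[of "mk q 1 0 0"] assms(2)[of "mk q \<i> 0 0"] c_pos F_zzbar_pos[OF assms(1)]
      phi_pos[of "snd q"]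
    by (simp add: G_def hm_def complex_eq_iff)
  ultimately show ?thesis
    using mk_components[of w q] mk_components[of w' q] by simp
qed

text \<open>\<open>T z x y\<close> is the derivative along \<open>x\<close> of the contact form on the constant vector \<open>y\<close>.  Only its
  antisymmetric part, the exterior derivative of the contact form, has a geometric meaning; the
  symmetric part changes if the real part of a holomorphic function is added to \<open>F\<close>.\<close>

definition T :: "complex \<Rightarrow> complex \<Rightarrow> complex \<Rightarrow> real"
  where "T z x y = dir_deriv x F1 z * Im y - dir_deriv x F2 z * Re y"

lemma T_antisym:
  assumes "z \<in> U"
  shows "T z y x = T z x y - 2 * om z x y"
  unfolding T_def om_def f_eq[OF assms]
    has_derivative_complex_split[OF deriv_F1[OF assms], of x] has_derivative_complex_split[OF deriv_F2[OF assms], of x]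
    has_derivative_complex_split[OF deriv_F1[OF assms], of y] has_derivative_complex_split[OF deriv_F2[OF assms], of y]
  by (simp add: field_simps)

lemma deriv_compose_hz:
  assumes "(g has_derivative g') (at (hz q))"
  shows "((\<lambda>q. g (hz q)) has_derivative (\<lambda>v. g' (hz v))) (at q)"
  by (rule has_derivative_compose[where g = g and f = hz, OF _ assms])
    (auto intro!: derivative_eq_intros)

lemma deriv_compose_fibre:
  assumes "(g has_real_derivative D) (at (snd q))"
  shows "((\<lambda>q. g (snd q)) has_derivative (\<lambda>v. D * snd v)) (at q)"
  by (rule has_derivative_compose[where g = g and f = snd,
        OF _ assms[unfolded has_field_derivative_def]])
    (auto intro!: derivative_eq_intros)

lemma deriv_al:
  assumes "hz q \<in> U"
  shows "((\<lambda>q. al q w) has_derivative (\<lambda>v. T (hz q) (hz v) (hz w))) (at q)"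
  unfolding alpha_def T_def
  using deriv_compose_hz[OF deriv_F1[OF assms]] deriv_compose_hz[OF deriv_F2[OF assms]]
  by (auto intro!: derivative_eq_intros)

lemma deriv_hm:
  assumes "hz q \<in> U"
  shows "((\<lambda>q. hm (hz q) x y) has_derivative
    (\<lambda>v. 2 * Re (psi (hz q) * hz v) * hm (hz q) x y)) (at q)"
proof -
  have "((\<lambda>q. hm (hz q) x y) has_derivative
      (\<lambda>v. 2 * dir_deriv (hz v) f (hz q) * Re (cnj x * y))) (at q)"
    unfolding hm_def using deriv_compose_hz[OF deriv_f[OF assms]]
    by (auto intro!: derivative_eq_intros)
  then show ?thesis
    by (simp only: dir_deriv_f[OF assms] hm_def mult_ac)
qed

lemma deriv_phi: "((\<lambda>q::(complex \<times> real) \<times> real. phi (snd q)) has_derivative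
    (\<lambda>v. 2 * snd q * snd v)) (at q)"
  unfolding phi_def by (auto intro!: derivative_eq_intros)

lemma dir_deriv_G:
  assumes "hz q \<in> U"
  shows "dir_deriv u (\<lambda>q. G q v w) q =
    c * (2 * snd q * snd u * hm (hz q) (hz v) (hz w)
      + phi (snd q) * (2 * Re (psi (hz q) * hz u) * hm (hz q) (hz v) (hz w))
      + T (hz q) (hz u) (hz v) * snd w + T (hz q) (hz u) (hz w) * snd v
      + B1 (snd q) * snd u * al q v * al q w
      + B (snd q) * (T (hz q) (hz u) (hz v) * al q w + al q v * T (hz q) (hz u) (hz w)))"
proof (rule dir_deriv_eqI)
  show "((\<lambda>q. G q v w) has_derivative (\<lambda>u.
    c * (2 * snd q * snd u * hm (hz q) (hz v) (hz w)
      + phi (snd q) * (2 * Re (psi (hz q) * hz u) * hm (hz q) (hz v) (hz w))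
      + T (hz q) (hz u) (hz v) * snd w + T (hz q) (hz u) (hz w) * snd v
      + B1 (snd q) * snd u * al q v * al q w
      + B (snd q) * (T (hz q) (hz u) (hz v) * al q w + al q v * T (hz q) (hz u) (hz w))))) (at q)"
    unfolding G_def
    by (rule has_derivative_eq_rhs, (rule has_derivative_add deriv_al[OF assms] deriv_hm[OF assms]
        deriv_phi deriv_compose_fibre[OF deriv_B] has_derivative_const has_derivative_mult)+)
      (simp add: fun_eq_iff algebra_simps)
qed

text \<open>\<open>sigma s = (s + \<i>) / phi s\<close> collects the contributions of the derivative of \<open>phi\<close> (real part) and
  of the twist of the contact form (imaginary part) to the connection.\<close>

definition sigma :: "real \<Rightarrow> complex"
  where "sigma s = inverse (complex_of_real s - \<i>)"

definition beta :: "real \<Rightarrow> real"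
  where "beta s = B s / phi s"

lemma phi_sigma: "complex_of_real (phi s) * sigma s = complex_of_real s + \<i>"
proof -
  have "complex_of_real s - \<i> \<noteq> 0"
    by (simp add: complex_eq_iff)
  moreover have "complex_of_real (phi s) = (complex_of_real s + \<i>) * (complex_of_real s - \<i>)"
    by (simp add: phi_def algebra_simps power2_eq_square)
  ultimately show ?thesis
    by (simp add: sigma_def)
qed

lemma phi_beta: "phi s * beta s = B s"
  using phi_pos[of s] by (simp add: beta_def)

text \<open>Horizontal, contact and fibre components of the Levi-Civita derivative of the constant vector
  field \<open>w\<close> along \<open>v\<close>.  They are read off from the Koszul formula by sorting it by the components of
  its third argument.\<close>

definition LCz where "LCz q v w = psi (hz q) * hz v * hz w
  + sigma (snd q) * (complex_of_real (snd v) * hz w + complex_of_real (snd w) * hz v)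
  + \<i> * complex_of_real (beta (snd q)) *
      (complex_of_real (al q w) * hz v + complex_of_real (al q v) * hz w)"

definition LCa where "LCa q v w = (T (hz q) (hz v) (hz w) + T (hz q) (hz w) (hz v)) / 2
  - B1 (snd q) / 2 * (al q v * al q w) - snd q * hm (hz q) (hz v) (hz w)"

definition LCs where "LCs q v w = B1 (snd q) / 2 * (snd v * al q w + snd w * al q v)
  + B (snd q) * B1 (snd q) / 2 * (al q v * al q w)
  + B (snd q) * snd q * hm (hz q) (hz v) (hz w)"

definition LC where "LC q v w = mk q (LCz q v w) (LCa q v w) (LCs q v w)"

lemma LC_simps [simp]: "hz (LC q v w) = LCz q v w" "al q (LC q v w) = LCa q v w"
  "snd (LC q v w) = LCs q v w"
  by (simp_all add: LC_def)

text \<open>Multiplication by \<open>phi\<close> clears the denominators, so that the Koszul formula becomes a polynomial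
  identity.\<close>

lemma phi_hm_LCz: "phi (snd q) * hm z (LCz q v w) u =
  phi (snd q) * hm z (psi (hz q) * hz v * hz w) u
  + snd q * (snd v * hm z (hz w) u + snd w * hm z (hz v) u)
  + (snd v * om z (hz w) u + snd w * om z (hz v) u)
  + B (snd q) * (al q w * om z (hz v) u + al q v * om z (hz w) u)"
proof -
  have *: "phi s * hm z x u = hm z (complex_of_real (phi s) * x) u" for s x
    by (simp add: hm_def algebra_simps)
  have "complex_of_real (phi (snd q)) * LCz q v w =
      complex_of_real (phi (snd q)) * (psi (hz q) * hz v * hz w)
      + (complex_of_real (phi (snd q)) * sigma (snd q)) *
          (complex_of_real (snd v) * hz w + complex_of_real (snd w) * hz v)
      + \<i> * complex_of_real (phi (snd q) * beta (snd q)) *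
          (complex_of_real (al q w) * hz v + complex_of_real (al q v) * hz w)"
    by (simp add: LCz_def algebra_simps)
  then show ?thesis
    unfolding * phi_sigma phi_beta by (simp add: hm_def om_def algebra_simps)
qed

lemma levi_civita_G:
  assumes "hz q \<in> U"
  shows "levi_civita G q v w = LC q v w"
  unfolding levi_civita_def
proof (rule sharp_eqI)
  fix u
  have psi_hm: "hm (hz q) (psi (hz q) * hz v * hz w) (hz u) =
      Re (psi (hz q) * hz v) * hm (hz q) (hz w) (hz u)
      + Re (psi (hz q) * hz w) * hm (hz q) (hz v) (hz u)
      - Re (psi (hz q) * hz u) * hm (hz q) (hz v) (hz w)"
    by (simp add: hm_def algebra_simps)
  show "G q (LC q v w) u = (dir_deriv v (\<lambda>q. G q w u) q + dir_deriv w (\<lambda>q. G q v u) q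
      - dir_deriv u (\<lambda>q. G q v w) q) / 2"
    unfolding dir_deriv_G[OF assms] unfolding G_def LC_simps phi_hm_LCz psi_hm
      T_antisym[OF assms, of "hz u"] LCa_def LCs_def
    by (simp add: algebra_simps add_divide_distrib diff_divide_distrib)
next
  show "w' = LC q v w" if "\<And>u. G q w' u = G q (LC q v w) u" for w'
    using G_nondegenerate[OF assms that] .
qed

end

section \<open>The Riemann tensor of the lift\<close>

context sasakian_lift
begin

text \<open>Second derivatives of the contact form; their symmetry in the two directions is what removes
  them from the curvature.\<close>

definition TT :: "complex \<Rightarrow> complex \<Rightarrow> complex \<Rightarrow> complex \<Rightarrow> real"
  where "TT z x y w = dir_deriv x (dir_deriv y F1) z * Im w - dir_deriv x (dir_deriv y F2) z * Re w"

lemma TT_commute: "z \<in> U \<Longrightarrow> TT z x y w = TT z y x w"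
  unfolding TT_def
  using dir_deriv_commute[OF smooth_F1 open_U] dir_deriv_commute[OF smooth_F2 open_U] by metis

lemma deriv_T:
  assumes "hz q \<in> U"
  shows "((\<lambda>q. T (hz q) y w) has_derivative (\<lambda>u. TT (hz q) (hz u) y w)) (at q)"
  unfolding T_def TT_def
  using deriv_compose_hz[OF smooth_on_has_derivative[OF smooth_on_dir_deriv[OF smooth_F1] open_U assms]]
    deriv_compose_hz[OF smooth_on_has_derivative[OF smooth_on_dir_deriv[OF smooth_F2] open_U assms]]
  by (intro has_derivative_diff has_derivative_mult_left) auto

definition beta1 :: "real \<Rightarrow> real"
  where "beta1 s = (B1 s * phi s - B s * (2 * s)) / (phi s)\<^sup>2"

lemma deriv_beta: "(beta has_real_derivative beta1 s) (at s)"
proof -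
  have "(phi has_real_derivative 2 * s) (at s)"
    unfolding phi_def by (auto intro!: derivative_eq_intros)
  then show ?thesis
    unfolding beta_def beta1_def using DERIV_divide[OF deriv_B] phi_pos[of s]
    by (simp add: power2_eq_square)
qed

lemma deriv_sigma: "((\<lambda>q::(complex \<times> real) \<times> real. sigma (snd q)) has_derivative
    (\<lambda>u. - (sigma (snd q))\<^sup>2 * complex_of_real (snd u))) (at q)"
proof -
  have "complex_of_real (snd q) - \<i> \<noteq> 0"
    by (simp add: complex_eq_iff)
  then show ?thesis
    unfolding sigma_def by (auto intro!: derivative_eq_intros simp: power2_eq_square mult_ac)
qed

text \<open>The derivatives along \<open>u\<close> of \<open>LCz\<close>, \<open>LCa\<close> and \<open>LCs\<close> for constant \<open>v\<close> and \<open>w\<close>.\<close>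

definition DLCz where "DLCz q u v w = dpsi (hz q) (hz u) * hz v * hz w
  - (sigma (snd q))\<^sup>2 * complex_of_real (snd u) *
      (complex_of_real (snd v) * hz w + complex_of_real (snd w) * hz v)
  + \<i> * complex_of_real (beta1 (snd q) * snd u) *
      (complex_of_real (al q w) * hz v + complex_of_real (al q v) * hz w)
  + \<i> * complex_of_real (beta (snd q)) *
      (complex_of_real (T (hz q) (hz u) (hz w)) * hz v
        + complex_of_real (T (hz q) (hz u) (hz v)) * hz w)"

definition DLCa where "DLCa q u v w =
  (TT (hz q) (hz u) (hz v) (hz w) + TT (hz q) (hz u) (hz w) (hz v)) / 2
  - B2 (snd q) / 2 * snd u * (al q v * al q w)
  - B1 (snd q) / 2 * (T (hz q) (hz u) (hz v) * al q w + al q v * T (hz q) (hz u) (hz w))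
  - snd u * hm (hz q) (hz v) (hz w)
  - snd q * (2 * Re (psi (hz q) * hz u) * hm (hz q) (hz v) (hz w))"

definition DLCs where "DLCs q u v w =
  B2 (snd q) / 2 * snd u * (snd v * al q w + snd w * al q v)
  + B1 (snd q) / 2 * (snd v * T (hz q) (hz u) (hz w) + snd w * T (hz q) (hz u) (hz v))
  + (B1 (snd q) * B1 (snd q) + B (snd q) * B2 (snd q)) / 2 * snd u * (al q v * al q w)
  + B (snd q) * B1 (snd q) / 2 *
      (T (hz q) (hz u) (hz v) * al q w + al q v * T (hz q) (hz u) (hz w))
  + (B1 (snd q) * snd q + B (snd q)) * snd u * hm (hz q) (hz v) (hz w)
  + B (snd q) * snd q * (2 * Re (psi (hz q) * hz u) * hm (hz q) (hz v) (hz w))"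

lemma deriv_LCz:
  assumes "hz q \<in> U"
  shows "((\<lambda>q. LCz q v w) has_derivative (\<lambda>u. DLCz q u v w)) (at q)"
  unfolding LCz_def
  by (rule has_derivative_eq_rhs, (rule has_derivative_add deriv_compose_hz[OF deriv_psi[OF assms]]
      deriv_sigma has_derivative_of_real[OF deriv_al[OF assms]]
      has_derivative_of_real[OF deriv_compose_fibre[OF deriv_beta]]
      has_derivative_const has_derivative_mult)+)
    (simp add: fun_eq_iff DLCz_def algebra_simps)

lemma deriv_LCa:
  assumes "hz q \<in> U"
  shows "((\<lambda>q. LCa q v w) has_derivative (\<lambda>u. DLCa q u v w)) (at q)"
  unfolding LCa_def divide_inverse
  by (rule has_derivative_eq_rhs, (rule has_derivative_add has_derivative_diff
      deriv_T[OF assms] deriv_al[OF assms] deriv_hm[OF assms] deriv_compose_fibre[OF deriv_B1]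
      has_derivative_snd[OF has_derivative_ident] has_derivative_const has_derivative_mult)+)
    (simp add: fun_eq_iff DLCa_def field_simps)

lemma deriv_LCs:
  assumes "hz q \<in> U"
  shows "((\<lambda>q. LCs q v w) has_derivative (\<lambda>u. DLCs q u v w)) (at q)"
  unfolding LCs_def divide_inverse
  by (rule has_derivative_eq_rhs, (rule has_derivative_add has_derivative_diff
      deriv_T[OF assms] deriv_al[OF assms] deriv_hm[OF assms]
      deriv_compose_fibre[OF deriv_B1] deriv_compose_fibre[OF deriv_B]
      has_derivative_snd[OF has_derivative_ident] has_derivative_const has_derivative_mult)+)
    (simp add: fun_eq_iff DLCs_def field_simps)

text \<open>The contact component of a vector depends on the base point, so that the contact component of
  a derivative is not the derivative of the contact component: the difference is the \<open>T\<close> term.\<close>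

lemma deriv_LC:
  assumes "hz q \<in> U"
  shows "((\<lambda>q. LC q v w) has_derivative
    (\<lambda>u. mk q (DLCz q u v w) (DLCa q u v w - T (hz q) (hz u) (LCz q v w)) (DLCs q u v w))) (at q)"
proof -
  note F1' = deriv_compose_hz[OF deriv_F1[OF assms]] and F2' = deriv_compose_hz[OF deriv_F2[OF assms]]
  have Re_Im: "((\<lambda>q. Re (LCz q v w)) has_derivative (\<lambda>u. Re (DLCz q u v w))) (at q)"
    "((\<lambda>q. Im (LCz q v w)) has_derivative (\<lambda>u. Im (DLCz q u v w))) (at q)"
    by (rule bounded_linear.has_derivative[OF bounded_linear_Re deriv_LCz[OF assms]]
        bounded_linear.has_derivative[OF bounded_linear_Im deriv_LCz[OF assms]])+
  show ?thesis
    unfolding LC_def mk_def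
    by (rule has_derivative_eq_rhs, (rule has_derivative_Pair has_derivative_add has_derivative_diff
        deriv_LCz[OF assms] deriv_LCa[OF assms] deriv_LCs[OF assms] F1' F2' Re_Im
        has_derivative_mult)+)
      (simp add: fun_eq_iff T_def algebra_simps)
qed

lemma riemann_G:
  assumes "hz q \<in> U"
  shows "riemann G q u v w =
    mk q (DLCz q u v w) (DLCa q u v w - T (hz q) (hz u) (LCz q v w)) (DLCs q u v w)
    - mk q (DLCz q v u w) (DLCa q v u w - T (hz q) (hz v) (LCz q u w)) (DLCs q v u w)
    + LC q u (LC q v w) - LC q v (LC q u w)"
proof -
  have "dir_deriv u (\<lambda>q. levi_civita G q v w) q =
      mk q (DLCz q u v w) (DLCa q u v w - T (hz q) (hz u) (LCz q v w)) (DLCs q u v w)" for u v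
  proof -
    have "dir_deriv u (\<lambda>q. levi_civita G q v w) q = dir_deriv u (\<lambda>q. LC q v w) q"
      by (rule dir_deriv_cong_open[of "(U \<times> UNIV) \<times> UNIV"])
        (use assms open_U in \<open>auto simp: open_Times mem_Times_iff levi_civita_G\<close>)
    then show ?thesis
      using dir_deriv_eqI[OF deriv_LC[OF assms]] by simp
  qed
  then show ?thesis
    by (simp add: riemann_def levi_civita_G[OF assms])
qed

lemma riemann_components:
  assumes "hz q \<in> U"
  shows "hz (riemann G q u v w) =
      DLCz q u v w - DLCz q v u w + LCz q u (LC q v w) - LCz q v (LC q u w)"
    and "al q (riemann G q u v w) =
      DLCa q u v w - T (hz q) (hz u) (LCz q v w) - (DLCa q v u w - T (hz q) (hz v) (LCz q u w))
      + LCa q u (LC q v w) - LCa q v (LC q u w)"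
    and "snd (riemann G q u v w) =
      DLCs q u v w - DLCs q v u w + LCs q u (LC q v w) - LCs q v (LC q u w)"
  unfolding riemann_G[OF assms] LC_def[of q u "LC q v w"] LC_def[of q v "LC q u w"] mk_add mk_diff
  by simp_all

text \<open>The next lemmas give the components of \<open>R(u, v) w\<close>, with \<open>u\<close> in an adapted frame, that enter the
  Ricci tensor and the Weyl components.  Their proofs cancel the second derivatives of \<open>F\<close> by writing
  every \<open>T(x, y)\<close> in one fixed order of the arguments; what remains of them is the Kaehler form, from
  \<open>T(x, y) - T(y, x) = 2 om(x, y)\<close>.\<close>

lemma riemann_horizontal:
  assumes "hz q \<in> U"
  shows "hz (riemann G q (mk q x 0 0) v w) =
    - \<i> * complex_of_real (k * om (hz q) x (hz v)) * hz w
    + (sigma (snd q))\<^sup>2 * complex_of_real (snd v * snd w) * x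
    - \<i> * complex_of_real (beta1 (snd q) * snd v * al q w) * x
    + \<i> * complex_of_real (beta (snd q)) *
        (2 * complex_of_real (om (hz q) x (hz v)) * hz w
          + complex_of_real (om (hz q) x (hz w)) * hz v
          - complex_of_real (om (hz q) (hz v) (hz w)) * x)
    + x * (sigma (snd q) * complex_of_real (LCs q v w)
        + \<i> * complex_of_real (beta (snd q) *
            (- B1 (snd q) / 2 * (al q v * al q w) - snd q * hm (hz q) (hz v) (hz w))))
    - x * (sigma (snd q) * complex_of_real (snd v) + \<i> * complex_of_real (beta (snd q) * al q v))
        * (sigma (snd q) * complex_of_real (snd w) + \<i> * complex_of_real (beta (snd q) * al q w))
    - hz v * complex_of_real (hm (hz q) x (hz w)) *
        (sigma (snd q) * complex_of_real (B (snd q) * snd q)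
          - \<i> * complex_of_real (beta (snd q) * snd q))"
proof -
  have dpsi: "dpsi (hz q) x * hz v = dpsi (hz q) (hz v) * x
      - \<i> * complex_of_real (k * om (hz q) x (hz v))"
    using dpsi_commutator[OF assms, of x "hz v"] by (simp add: om_def algebra_simps)
  have T: "T (hz q) (hz v) x = T (hz q) x (hz v) - 2 * om (hz q) x (hz v)"
    "T (hz q) (hz w) x = T (hz q) x (hz w) - 2 * om (hz q) x (hz w)"
    "T (hz q) (hz w) (hz v) = T (hz q) (hz v) (hz w) - 2 * om (hz q) (hz v) (hz w)"
    using T_antisym[OF assms] by blast+
  show ?thesis
    unfolding riemann_components[OF assms] DLCz_def LCz_def[of q "mk q x 0 0" "LC q v w"]
      LCz_def[of q v "LC q (mk q x 0 0) w"] LC_simps mk_simps dpsi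
    unfolding LCa_def LCs_def LCz_def mk_simps T
    by (simp add: algebra_simps power2_eq_square add_divide_distrib diff_divide_distrib)
qed

lemma zeros:
  assumes "z \<in> U"
  shows "T z 0 y = 0" "T z y 0 = 0" "TT z 0 y w = 0" "TT z y 0 w = 0" "TT z y w 0 = 0"
    "dpsi z 0 = 0"
proof -
  have 0: "dir_deriv 0 g z = 0" if "smooth_on U g" for g :: "complex \<Rightarrow> real"
    using linear_0[OF linear_dir_deriv[OF smooth_on_differentiable[OF that open_U assms]]] by simp
  show "T z 0 y = 0" "T z y 0 = 0" "TT z y w 0 = 0"
    by (simp_all add: T_def TT_def 0[OF smooth_F1] 0[OF smooth_F2])
  show *: "TT z 0 y w = 0"
    by (simp add: TT_def 0[OF smooth_on_dir_deriv[OF smooth_F1]]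
        0[OF smooth_on_dir_deriv[OF smooth_F2]])
  show "TT z y 0 w = 0"
    using TT_commute[OF assms] * by simp
  show "dpsi z 0 = 0"
    using linear_0[OF has_derivative_linear[OF deriv_psi[OF assms]]] .
qed

lemma riemann_contact:
  assumes "hz q \<in> U"
  shows "al q (riemann G q (mk q 0 1 0) v w) =
    B2 (snd q) / 2 * snd v * al q w
    + (beta (snd q) + B1 (snd q) / 2 * snd q) * hm (hz q) (hz v) (hz w)
    + (B1 (snd q) / 2 - snd q * beta (snd q)) * om (hz q) (hz v) (hz w)"
proof -
  have T: "T (hz q) (hz w) (hz v) = T (hz q) (hz v) (hz w) - 2 * om (hz q) (hz v) (hz w)"
    using T_antisym[OF assms] by blast
  have T': "T (hz q) x (LCz q (mk q 0 1 0) w) = T (hz q) (LCz q (mk q 0 1 0) w) x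
      + 2 * om (hz q) x (LCz q (mk q 0 1 0) w)" for x
    using T_antisym[OF assms, of "LCz q (mk q 0 1 0) w" x] by simp
  have z: "LCz q (mk q 0 1 0) w = \<i> * complex_of_real (beta (snd q)) * hz w"
    by (simp add: LCz_def)
  show ?thesis
    unfolding riemann_components[OF assms] DLCa_def LCa_def[of q "mk q 0 1 0" "LC q v w"]
      LCa_def[of q v "LC q (mk q 0 1 0) w"] LC_simps mk_simps T' zeros[OF assms]
    unfolding LCa_def LCs_def mk_simps T zeros[OF assms] z
    by (simp add: hm_def om_def algebra_simps power2_eq_square add_divide_distrib diff_divide_distrib)
qed

lemma sigma_eq: "sigma s * (complex_of_real s - \<i>) = 1"
  by (simp add: sigma_def complex_eq_iff)

text \<open>The imaginary and real parts of the relation \<open>(s - \<i>) sigma(s) = 1\<close>, applied to the Hermitian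
  form \<open>hm + \<i> om\<close>.\<close>

lemma om_hm_sigma: "om z x (sigma s * y) = hm z x y - s * hm z x (sigma s * y)"
proof -
  define W where "W = cnj x * (sigma s * y)"
  have "cnj x * y = W * (complex_of_real s - \<i>)"
    using sigma_eq[of s] by (simp add: W_def mult_ac)
  then have "Re (cnj x * y) = Re (W * (complex_of_real s - \<i>))"
    by (simp only:)
  also have "\<dots> = Im W + s * Re W"
    by (simp add: algebra_simps)
  finally show ?thesis
    unfolding om_def hm_def W_def[symmetric] by (simp add: algebra_simps)
qed

lemma phi_hm_sigma: "phi s * hm z x (sigma s * y) = s * hm z x y - om z x y"
proof -
  have "phi s * hm z x (sigma s * y) = hm z x (complex_of_real (phi s) * sigma s * y)"
    by (simp add: hm_def algebra_simps)
  then show ?thesis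
    unfolding phi_sigma by (simp add: hm_def om_def algebra_simps)
qed

lemma riemann_fibre_horizontal:
  assumes "hz q \<in> U"
  shows "hz (riemann G q (mk q 0 0 1) v w) =
      \<i> * complex_of_real (beta1 (snd q)) *
          (complex_of_real (al q w) * hz v + complex_of_real (al q v) * hz w)
      + (\<i> * complex_of_real (beta (snd q)) - complex_of_real (B1 (snd q) / 2)) * sigma (snd q)
          * complex_of_real (al q w) * hz v"
proof -
  have T: "T (hz q) (hz w) (hz v) = T (hz q) (hz v) (hz w) - 2 * om (hz q) (hz v) (hz w)"
    using T_antisym[OF assms] by blast
  show ?thesis
    unfolding riemann_components[OF assms] DLCz_def LCz_def[of q "mk q 0 0 1" "LC q v w"]
      LCz_def[of q v "LC q (mk q 0 0 1) w"] LC_simps mk_simps zeros[OF assms]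
    unfolding LCa_def LCs_def LCz_def mk_simps T zeros[OF assms]
    by (simp add: hm_def algebra_simps power2_eq_square add_divide_distrib diff_divide_distrib)
qed

text \<open>That this vanishes for horizontal \<open>w\<close> is the reason for the vanishing of two Weyl components.\<close>

lemma riemann_fibre_contact:
  assumes "hz q \<in> U"
  shows "al q (riemann G q (mk q 0 0 1) v w) = - B2 (snd q) / 2 * (al q v * al q w)"
proof -
  have T: "T (hz q) (hz w) (hz v) = T (hz q) (hz v) (hz w) - 2 * om (hz q) (hz v) (hz w)"
    using T_antisym[OF assms] by blast
  have z: "LCz q (mk q 0 0 1) w = sigma (snd q) * hz w"
    by (simp add: LCz_def)
  have T': "T (hz q) x (LCz q (mk q 0 0 1) w) = T (hz q) (LCz q (mk q 0 0 1) w) x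
      + 2 * om (hz q) x (LCz q (mk q 0 0 1) w)" for x
    using T_antisym[OF assms, of "LCz q (mk q 0 0 1) w" x] by simp
  show ?thesis
    unfolding riemann_components[OF assms] DLCa_def LCa_def[of q "mk q 0 0 1" "LC q v w"]
      LCa_def[of q v "LC q (mk q 0 0 1) w"] LC_simps mk_simps T' zeros[OF assms]
    unfolding LCa_def LCs_def mk_simps T zeros[OF assms] z om_hm_sigma
    by (simp add: algebra_simps hm_def[of _ 0] om_def[of _ 0] hm_def[of _ _ 0]
        add_divide_distrib diff_divide_distrib)
qed

lemma riemann_fibre_vertical:
  assumes "hz q \<in> U"
  shows "snd (riemann G q (mk q 0 0 1) v w) =
      B2 (snd q) / 2 * al q v * (snd w + B (snd q) * al q w)
      + (B1 (snd q) / 2 * snd q + B (snd q) - (snd q)\<^sup>2 * beta (snd q)) * hm (hz q) (hz v) (hz w)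
      - (B1 (snd q) / 2 - snd q * beta (snd q)) * om (hz q) (hz v) (hz w)"
proof -
  have T: "T (hz q) (hz w) (hz v) = T (hz q) (hz v) (hz w) - 2 * om (hz q) (hz v) (hz w)"
    using T_antisym[OF assms] by blast
  have z: "LCz q (mk q 0 0 1) w = sigma (snd q) * hz w"
    by (simp add: LCz_def)
  have hm: "B s * hm z x (sigma s * y) = beta s * (s * hm z x y - om z x y)" for s z x y
    using phi_hm_sigma[of s z x y] phi_beta[of s] by algebra
  have hm': "B s * (t * hm z x (sigma s * y)) = t * (beta s * (s * hm z x y - om z x y))"
    for s t z x y
    using hm[of s z x y] by algebra
  show ?thesis
    unfolding riemann_components[OF assms] DLCs_def LCs_def[of q "mk q 0 0 1" "LC q v w"]
      LCs_def[of q v "LC q (mk q 0 0 1) w"] LC_simps mk_simps zeros[OF assms]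
    unfolding LCa_def LCs_def mk_simps T zeros[OF assms] z mult.assoc hm hm'
    by (simp add: algebra_simps hm_def[of _ 0] hm_def[of _ _ 0] power2_eq_square
        add_divide_distrib diff_divide_distrib)
qed

end

section \<open>The Ricci tensor of the lift\<close>

context sasakian_lift
begin

lemma T_linear:
  assumes "z \<in> U"
  shows "T z (x + x') y = T z x y + T z x' y" "T z (t *\<^sub>R x) y = t * T z x y"
    "T z x (y + y') = T z x y + T z x y'" "T z x (t *\<^sub>R y) = t * T z x y"
proof -
  note l1 = linear_dir_deriv[OF smooth_on_differentiable[OF smooth_F1 open_U assms]]
    and l2 = linear_dir_deriv[OF smooth_on_differentiable[OF smooth_F2 open_U assms]]
  show "T z (x + x') y = T z x y + T z x' y" "T z (t *\<^sub>R x) y = t * T z x y"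
    "T z x (y + y') = T z x y + T z x y'" "T z x (t *\<^sub>R y) = t * T z x y"
    by (simp_all add: T_def linear_add[OF l1] linear_add[OF l2] linear_cmul[OF l1]
        linear_cmul[OF l2] algebra_simps)
qed

lemma TT_linear:
  assumes "z \<in> U"
  shows "TT z v (x + x') y = TT z v x y + TT z v x' y" "TT z v (t *\<^sub>R x) y = t * TT z v x y"
    "TT z v x (y + y') = TT z v x y + TT z v x y'" "TT z v x (t *\<^sub>R y) = t * TT z v x y"
proof -
  note l1 = linear_dir_deriv[OF smooth_on_differentiable[OF smooth_on_dir_deriv[OF smooth_F1] open_U assms]]
    and l2 = linear_dir_deriv[OF smooth_on_differentiable[OF smooth_on_dir_deriv[OF smooth_F2] open_U assms]]
  show "TT z v (x + x') y = TT z v x y + TT z v x' y" "TT z v (t *\<^sub>R x) y = t * TT z v x y"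
    unfolding TT_commute[OF assms, of v]
    by (simp_all add: TT_def linear_add[OF l1] linear_add[OF l2] linear_cmul[OF l1]
        linear_cmul[OF l2] algebra_simps)
  show "TT z v x (y + y') = TT z v x y + TT z v x y'" "TT z v x (t *\<^sub>R y) = t * TT z v x y"
    by (simp_all add: TT_def algebra_simps)
qed

lemma alpha_linear: "alpha z (v + w) = alpha z v + alpha z w" "alpha z (t *\<^sub>R v) = t * alpha z v"
  by (simp_all add: alpha_def algebra_simps)

lemma hm_linear: "hm z (x + x') y = hm z x y + hm z x' y" "hm z (t *\<^sub>R x) y = t * hm z x y"
  by (simp_all add: hm_def algebra_simps)

lemmas component_linear = T_linear[unfolded scaleR_conv_of_real] TT_linear[unfolded scaleR_conv_of_real]

lemma LCz_linear:
  "LCz q (u + u') w = LCz q u w + LCz q u' w" "LCz q (t *\<^sub>R u) w = t *\<^sub>R LCz q u w"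
  by (simp_all add: LCz_def alpha_linear scaleR_conv_of_real algebra_simps)

lemma linear_LC:
  assumes "hz q \<in> U"
  shows "linear (\<lambda>u. LC q u w)" "linear (\<lambda>u. LC q v u)"
proof -
  show *: "linear (\<lambda>u. LC q u w)" for w
    by (rule linearI; unfold LC_def mk_add mk_scale LCz_linear LCa_def LCs_def)
      (simp_all add: component_linear[OF assms] hm_linear[unfolded scaleR_conv_of_real] alpha_linear scaleR_conv_of_real algebra_simps
        add_divide_distrib)
  have "LC q v u = LC q u v" for u
    by (simp add: LC_def LCz_def LCa_def LCs_def hm_def algebra_simps)
  then show "linear (\<lambda>u. LC q v u)"
    using * by simp
qed

lemma linear_riemann_G:
  assumes "hz q \<in> U"
  shows "linear (\<lambda>u. riemann G q u v w)"
proof -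
  have "linear (\<lambda>u. mk q (DLCz q v u w) (DLCa q v u w - T (hz q) (hz v) (LCz q u w)) (DLCs q v u w))"
    by (rule linearI; unfold mk_add mk_scale LCz_linear T_linear[OF assms] DLCz_def DLCa_def DLCs_def)
      (simp_all add: component_linear[OF assms] hm_linear[unfolded scaleR_conv_of_real] alpha_linear
        scaleR_conv_of_real algebra_simps add_divide_distrib)
  moreover have "linear (\<lambda>u. LC q v (LC q u w))"
    using linear_compose[OF linear_LC(1)[OF assms] linear_LC(2)[OF assms]] by (simp add: o_def)
  ultimately show ?thesis
    unfolding riemann_G[OF assms]
    by (intro linear_compose_sub linear_compose_add linear_LC(1)[OF assms]
        has_derivative_linear[OF deriv_LC[OF assms]])
qed

text \<open>The trace of an endomorphism, computed in the frame of horizontal lifts, \<open>\<partial>\<^sub>u\<close> and \<open>\<partial>\<^sub>s\<close> and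
  in the dual coframe \<open>dx\<close>, \<open>dy\<close>, \<open>\<alpha>\<close>, \<open>ds\<close> instead of the standard basis.\<close>

lemma trace_adapted:
  fixes L :: "(complex \<times> real) \<times> real \<Rightarrow> (complex \<times> real) \<times> real"
  assumes "linear L"
  shows "(\<Sum>b\<in>Basis. L b \<bullet> b) = Re (hz (L (mk q 1 0 0))) + Im (hz (L (mk q \<i> 0 0)))
    + al q (L (mk q 0 1 0)) + snd (L (mk q 0 0 1))"
proof -
  have "mk q 1 0 0 = ((1, 0), 0) + F2 (hz q) *\<^sub>R ((0, 1), 0)"
    "mk q \<i> 0 0 = ((\<i>, 0), 0) + (- F1 (hz q)) *\<^sub>R ((0, 1), 0)"
    "mk q 0 1 0 = ((0, 1), 0)" "mk q 0 0 1 = ((0, 0), 1)"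
    by (simp_all add: mk_def)
  moreover have "(\<Sum>b\<in>Basis. L b \<bullet> b) = L ((1, 0), 0) \<bullet> ((1, 0), 0) + L ((\<i>, 0), 0) \<bullet> ((\<i>, 0), 0)
      + L ((0, 1), 0) \<bullet> ((0, 1), 0) + L ((0, 0), 1) \<bullet> ((0, 0), 1)"
  proof -
    have basis: "(Basis :: ((complex \<times> real) \<times> real) set) =
        {((1, 0), 0), ((\<i>, 0), 0), ((0, 1), 0), ((0, 0), 1)}"
      by (auto simp: Basis_prod_def Basis_complex_def zero_prod_def)
    show ?thesis
      unfolding basis by (simp add: complex_eq_iff)
  qed
  ultimately show ?thesis
    by (simp add: linear_add[OF assms] linear_diff[OF assms]
        linear_cmul[OF assms] alpha_def inner_complex_def inner_prod_def del: scaleR_Pair add_Pair)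
qed

lemma Re_sigma: "Re (sigma s) = s / phi s" and Im_sigma: "Im (sigma s) = 1 / phi s"
  using phi_sigma[of s] phi_pos[of s] by (auto simp: complex_eq_iff field_simps)

lemma horizontal_trace:
  assumes "hz q \<in> U"
  shows "Re (hz (riemann G q (mk q 1 0 0) v w)) + Im (hz (riemann G q (mk q \<i> 0 0) v w)) =
    (k - 3 * beta (snd q) - (snd q)\<^sup>2 * beta (snd q)) * hm (hz q) (hz v) (hz w)
    + 2 * (snd q / phi (snd q)) * LCs q v w + 2 * (beta (snd q))\<^sup>2 * (al q v * al q w)
    + 2 * beta (snd q) / phi (snd q) * (snd v * al q w + snd w * al q v)"
proof -
  define s where "s = snd q"
  define i where "i = inverse (phi s)"
  have sig: "Re (sigma s) = s * i" "Im (sigma s) = i" and beta: "beta s = B s * i"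
    by (simp_all add: Re_sigma Im_sigma beta_def i_def divide_inverse)
  show ?thesis
    unfolding riemann_horizontal[OF assms] s_def[symmetric] divide_inverse[of _ "phi s"] i_def[symmetric]
    by (simp add: hm_def om_def sig beta power2_eq_square algebra_simps)
qed

text \<open>The terms with the Kaehler form in the last two summands of the trace cancel, as the symmetry of
  the Ricci tensor demands.\<close>

lemma ricci_G:
  assumes "hz q \<in> U"
  shows "ricci G q v w =
    (k - 2 * beta (snd q) + snd q * B1 (snd q) + B (snd q)) * hm (hz q) (hz v) (hz w)
    + (B2 (snd q) / 2 + (snd q * B1 (snd q) + 2 * beta (snd q)) / phi (snd q))
      * (al q v * snd w + al q w * snd v + B (snd q) * al q v * al q w)"
proof -
  define s where "s = snd q"
  define i where "i = inverse (phi s)"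
  have beta: "beta s = B s * i"
    by (simp add: beta_def i_def divide_inverse)
  have "ricci G q v w = Re (hz (riemann G q (mk q 1 0 0) v w)) + Im (hz (riemann G q (mk q \<i> 0 0) v w))
    + al q (riemann G q (mk q 0 1 0) v w) + snd (riemann G q (mk q 0 0 1) v w)"
    unfolding ricci_def by (rule trace_adapted[OF linear_riemann_G[OF assms]])
  also have "\<dots> = (k - 2 * beta s + s * B1 s + B s) * hm (hz q) (hz v) (hz w)
    + (B2 s / 2 + (s * B1 s + 2 * beta s) * i)
      * (al q v * snd w + al q w * snd v + B s * al q v * al q w)"
    unfolding horizontal_trace[OF assms] riemann_contact[OF assms] riemann_fibre_vertical[OF assms]
      LCs_def s_def[symmetric] beta divide_inverse[of _ "phi s"] i_def[symmetric]
    by (simp add: algebra_simps add_divide_distrib diff_divide_distrib power2_eq_square)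
  finally show ?thesis
    unfolding s_def i_def by (simp only: divide_inverse)
qed

end

section \<open>Einstein metrics: scalar curvature and Weyl tensor\<close>

text \<open>For an Einstein metric the trace part of the curvature is that of a space of constant sectional
  curvature \<open>\<kappa> / 3\<close>.\<close>

lemma weyl_einstein:
  fixes g :: "'a::euclidean_space \<Rightarrow> 'a \<Rightarrow> 'a \<Rightarrow> real"
  assumes dim: "DIM('a) = 4"
    and ric: "\<And>v w. ricci g p v w = \<kappa> * g p v w"
    and nondeg: "\<And>w w'. (\<And>v. g p w' v = g p w v) \<Longrightarrow> w' = w"
    and scale: "\<And>t v w. g p (t *\<^sub>R v) w = t * g p v w"
  shows "weyl g p a b c d =
    g p (riemann g p a b d) c - \<kappa> / 3 * (g p a c * g p b d - g p a d * g p b c)"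
proof -
  have "sharp (g p) (ricci g p b) = \<kappa> *\<^sub>R b" for b
    by (rule sharp_eqI) (simp_all add: ric scale nondeg)
  then have "scalar_curvature g p = (\<Sum>b\<in>(Basis :: 'a set). \<kappa> * (b \<bullet> b))"
    by (simp add: scalar_curvature_def)
  also have "\<dots> = \<kappa> * 4"
    using dim by (simp add: inner_Basis)
  finally show ?thesis
    unfolding weyl_def ric dim by (simp add: field_simps)
qed

text \<open>Vectors that are orthogonal for \<open>b\<close> and not null are independent, hence a basis if there are
  enough of them.\<close>

lemma lorentzian_formI:
  fixes b :: "'a::euclidean_space \<Rightarrow> 'a \<Rightarrow> real"
  assumes "bilinear b" "\<And>v w. b v w = b w v" "finite E" "card E = DIM('a)" "t \<in> E" "b t t = -1"
    and "\<And>e. e \<in> E - {t} \<Longrightarrow> b e e = 1" "\<And>e e'. e \<in> E \<Longrightarrow> e' \<in> E \<Longrightarrow> e \<noteq> e' \<Longrightarrow> b e e' = 0"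
  shows "lorentzian_form b"
proof -
  have "independent E"
  proof (rule independent_if_scalars_zero[OF \<open>finite E\<close>])
    fix u e
    assume u: "(\<Sum>x\<in>E. u x *\<^sub>R x) = 0" and e: "e \<in> E"
    have lin: "linear (\<lambda>v. b v e)"
      using \<open>bilinear b\<close> by (simp add: bilinear_def)
    have "0 = b (\<Sum>x\<in>E. u x *\<^sub>R x) e"
      using u linear_0[OF lin] by simp
    also have "\<dots> = (\<Sum>x\<in>E. u x * b x e)"
      using linear_sum[OF lin, of "\<lambda>x. u x *\<^sub>R x" E] linear_cmul[OF lin] by simp
    also have "\<dots> = (\<Sum>x\<in>E. if x = e then u x * b x e else 0)"
      using assms(8) e by (intro sum.cong) auto
    also have "\<dots> = u e * b e e"
      using e \<open>finite E\<close> by simp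
    finally show "u e = 0"
      using assms(6) assms(7)[of e] e by (cases "e = t") auto
  qed
  moreover have "span E = UNIV"
    using card_ge_dim_independent[OF subset_UNIV \<open>independent E\<close>] assms(4) by auto
  ultimately show ?thesis
    unfolding lorentzian_form_def using assms by blast
qed

context sasakian_lift
begin

lemma einstein_G:
  assumes "\<And>s. k - 2 * beta s + s * B1 s + B s = \<kappa> * c * phi s"
    and "\<And>s. B2 s / 2 + (s * B1 s + 2 * beta s) / phi s = \<kappa> * c"
    and "hz q \<in> U"
  shows "ricci G q v w = \<kappa> * G q v w"
  unfolding ricci_G[OF assms(3)] assms(1,2) G_def by (simp add: algebra_simps)

lemma bilinear_G: "bilinear (G q)"
  unfolding bilinear_def
  by (intro conjI allI linearI) (simp_all add: G_def hm_def alpha_linear algebra_simps)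

lemma G_commute: "G q v w = G q w v"
  by (simp add: G_def hm_def algebra_simps)

lemma G_mk: "G q (mk q x a p) w = c * (phi (snd q) * hm (hz q) x (hz w)
    + a * snd w + al q w * p + B (snd q) * a * al q w)"
  by (simp add: G_def)

lemma lorentzian_G:
  assumes "hz q \<in> U"
  shows "lorentzian_form (G q)"
proof -
  let ?f = "f (hz q)" and ?B = "B (snd q)" and ?phi = "phi (snd q)"
  \<comment> \<open>normalizes the two horizontal vectors\<close>
  define m where "m = 1 / sqrt (2 * c * ?phi * ?f)"
  have "2 * c * ?phi * ?f > 0"
    using c_pos phi_pos F_zzbar_pos[OF assms] by simp
  then have m: "2 * c * ?phi * ?f * m\<^sup>2 = 1" "m \<noteq> 0"
    by (auto simp: m_def power_divide)
  \<comment> \<open>the fibre components of the last two vectors solve \<open>G v v = 1\<close> and \<open>G v v = - 1\<close>\<close>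
  let ?e1 = "mk q (of_real m) 0 0" and ?e2 = "mk q (\<i> * of_real m) 0 0"
    and ?e3 = "mk q 0 1 ((1 / c - ?B) / 2)" and ?t = "mk q 0 1 ((- 1 / c - ?B) / 2)"
  have ne: "?e1 \<noteq> ?e2" "?e1 \<noteq> ?e3" "?e1 \<noteq> ?t" "?e2 \<noteq> ?e3" "?e2 \<noteq> ?t" "?e3 \<noteq> ?t"
    using m(2) c_pos by (auto simp: eq_mk_iff complex_eq_iff field_simps)
  show ?thesis
  proof (rule lorentzian_formI[where E = "{?e1, ?e2, ?e3, ?t}" and t = ?t])
    show "card {?e1, ?e2, ?e3, ?t} = DIM((complex \<times> real) \<times> real)"
      using ne by simp
    show "G q ?t ?t = - 1"
      using c_pos by (simp add: G_mk hm_def field_simps)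
    show "G q e e = 1" if "e \<in> {?e1, ?e2, ?e3, ?t} - {?t}" for e
      using that m(1) c_pos by (auto simp: G_mk hm_def power2_eq_square field_simps)
    show "G q e e' = 0" if "e \<in> {?e1, ?e2, ?e3, ?t}" "e' \<in> {?e1, ?e2, ?e3, ?t}" "e \<noteq> e'" for e e'
      using that c_pos by (auto simp: G_mk hm_def field_simps)
  qed (use bilinear_G G_commute in auto)
qed

lemma weyl_fibre:
  assumes "hz q \<in> U" and ric: "\<And>v w. ricci G q v w = \<kappa> * G q v w"
  shows "weyl G q (mk q 0 0 t) v u w = t *
    (G q (riemann G q (mk q 0 0 1) v w) u
      - \<kappa> / 3 * (G q (mk q 0 0 1) u * G q v w - G q (mk q 0 0 1) w * G q v u))"
proof -
  have scale: "G q (t *\<^sub>R v) w = t * G q v w" for t v w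
    using bilinear_lmul[OF bilinear_G] by simp
  have t: "mk q 0 0 t = t *\<^sub>R mk q 0 0 1"
    by (simp add: mk_scale)
  have "weyl G q (mk q 0 0 t) v u w = G q (riemann G q (mk q 0 0 t) v w) u
      - \<kappa> / 3 * (G q (mk q 0 0 t) u * G q v w - G q (mk q 0 0 t) w * G q v u)"
    by (rule weyl_einstein[OF _ ric G_nondegenerate[OF assms(1)] scale]) simp_all
  also have "riemann G q (mk q 0 0 t) v w = t *\<^sub>R riemann G q (mk q 0 0 1) v w"
    unfolding t by (rule linear_cmul[OF linear_riemann_G[OF assms(1)]])
  finally show ?thesis
    unfolding t scale by (simp add: algebra_simps)
qed

lemma weyl_components:
  assumes "hz q \<in> U" and ric: "\<And>v w. ricci G q v w = \<kappa> * G q v w"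
  shows "weyl G q (mk q 0 0 t) (mk q x 0 0) (mk q 0 0 t') (mk q y 0 0) = 0"
    and "weyl G q (mk q 0 0 t) (mk q 0 a p) (mk q 0 0 t') (mk q y 0 0) = 0"
    and "weyl G q (mk q 0 0 t) (mk q x 0 0) (mk q 0 a p) (mk q y 0 0) = t * c * a *
      ((B1 (snd q) / 2 * snd q + beta (snd q) - \<kappa> * c / 3 * phi (snd q)) * hm (hz q) x y
        - (B1 (snd q) / 2 - snd q * beta (snd q)) * om (hz q) x y)"
proof -
  have "B s - s\<^sup>2 * beta s = beta s" for s
    using phi_beta[of s, symmetric] by (simp add: phi_def algebra_simps)
  then have B: "B1 s / 2 * s + B s - s\<^sup>2 * beta s = B1 s / 2 * s + beta s" for s
    by (simp add: add_diff_eq[symmetric])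
  note comps = riemann_fibre_horizontal[OF assms(1)] riemann_fibre_contact[OF assms(1)]
    riemann_fibre_vertical[OF assms(1), unfolded B]
  show "weyl G q (mk q 0 0 t) (mk q x 0 0) (mk q 0 0 t') (mk q y 0 0) = 0"
    "weyl G q (mk q 0 0 t) (mk q 0 a p) (mk q 0 0 t') (mk q y 0 0) = 0"
    by (simp_all add: weyl_fibre[OF assms] G_def comps hm_def)
  have "hm z 0 u = 0" "hm z u 0 = 0" for z u
    by (simp_all add: hm_def)
  then show "weyl G q (mk q 0 0 t) (mk q x 0 0) (mk q 0 a p) (mk q y 0 0) = t * c * a *
      ((B1 (snd q) / 2 * snd q + beta (snd q) - \<kappa> * c / 3 * phi (snd q)) * hm (hz q) x y
        - (B1 (snd q) / 2 - snd q * beta (snd q)) * om (hz q) x y)"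
    by (simp add: weyl_fibre[OF assms] G_def comps algebra_simps)
qed

section \<open>The lift\<close>

text \<open>These are forced by comparing coefficients in \<open>2 P\<^sup>2 (\<mu> cnj \<mu> + \<lambda> (dr + H \<lambda>))\<close>: the horizontal part
  gives \<open>P\<^sup>2 = c phi f\<close>, the mixed part \<open>dr = 2 ds / phi\<close>, and the last one \<open>H = 2 f B / phi\<close>.\<close>

definition lift_P :: "(complex \<times> real) \<times> real \<Rightarrow> real"
  where "lift_P q = sqrt (c * phi (snd q) * f (hz q))"
definition lift_r :: "(complex \<times> real) \<times> real \<Rightarrow> real"
  where "lift_r q = 2 * arctan (snd q)"
definition lift_H :: "(complex \<times> real) \<times> real \<Rightarrow> real"
  where "lift_H q = 2 * f (hz q) * beta (snd q)"

lemma lift_P: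
  assumes "hz q \<in> U"
  shows "lift_P q > 0" "(lift_P q)\<^sup>2 = c * phi (snd q) * f (hz q)"
proof -
  have "c * phi (snd q) * f (hz q) > 0"
    using c_pos phi_pos F_zzbar_pos[OF assms] by simp
  then show "lift_P q > 0" "(lift_P q)\<^sup>2 = c * phi (snd q) * f (hz q)"
    by (simp_all add: lift_P_def)
qed

lemma lift_form_eq: "lift_form mu lam lift_r (\<lambda>_. 0) lift_H q v =
  complex_of_real (2 / phi (snd q) * snd v + lift_H q * (al q v / (2 * f (hz q))))"
proof -
  have "(lift_r has_derivative (\<lambda>v. 2 / phi (snd q) * snd v)) (at q)"
    unfolding lift_r_def
    using deriv_compose_fibre[of "\<lambda>s. 2 * arctan s", OF DERIV_cmult[OF DERIV_arctan]]
    by (simp add: phi_def divide_inverse)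
  from frechet_derivative_at[OF this] have "frechet_derivative lift_r (at q) v = 2 / phi (snd q) * snd v"
    by metis
  then show ?thesis
    by (simp add: lift_form_def lam_def)
qed

lemma smooth_G:
  assumes "smooth_on UNIV B"
  shows "smooth_on ((U \<times> UNIV) \<times> UNIV) (\<lambda>q. G q v w)"
    and "smooth_on ((U \<times> UNIV) \<times> UNIV) lift_P"
    and "smooth_on ((U \<times> UNIV) \<times> UNIV) lift_r"
    and "smooth_on ((U \<times> UNIV) \<times> UNIV) lift_H"
proof -
  let ?S = "(U \<times> (UNIV :: real set)) \<times> (UNIV :: real set)"
  have S: "open ?S"
    by (intro open_Times open_U open_UNIV)
  have base: "smooth_on ?S (\<lambda>q. g (hz q))" if "smooth_on U g" for g :: "complex \<Rightarrow> real"
    by (rule smooth_on_o_linear[OF S open_U _ _ that])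
      (auto intro: bounded_linear_compose[OF bounded_linear_fst bounded_linear_fst])
  have fibre: "smooth_on ?S (\<lambda>q. h (snd q))" if "smooth_on UNIV h" for h :: "real \<Rightarrow> real"
    by (rule smooth_on_o_linear[OF S open_UNIV bounded_linear_snd _ that]) auto
  have "smooth_on UNIV phi"
    unfolding phi_def power2_eq_square
    by (intro smooth_on_add smooth_on_const smooth_on_mult smooth_on_ident open_UNIV)
  note sm = base[OF smooth_F1] base[OF smooth_F2] base[OF smooth_f] fibre[OF this]
    fibre[OF assms]
  show "smooth_on ?S (\<lambda>q. G q v w)"
    unfolding G_def alpha_def hm_def
    by (intro smooth_on_add smooth_on_mult smooth_on_diff smooth_on_const sm S)
  show "smooth_on ?S lift_P"
    unfolding lift_P_def using c_pos phi_pos F_zzbar_pos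
    by (intro smooth_on_sqrt smooth_on_mult smooth_on_const sm S) auto
  show "smooth_on ?S lift_r"
    unfolding lift_r_def by (intro smooth_on_mult smooth_on_const fibre[OF smooth_on_arctan] S)
  show "smooth_on ?S lift_H"
    unfolding lift_H_def beta_def using phi_pos
    by (intro smooth_on_mult smooth_on_divide smooth_on_const sm S) auto
qed

lemma lift_of_G:
  assumes "smooth_on UNIV B"
  shows "lift_of (U \<times> UNIV) (hyp_D F) (hyp_J F) G mu lam lift_P lift_r (\<lambda>_. 0) lift_H"
  unfolding lift_of_def lorentzian_metric_on_def
proof (intro conjI ballI allI)
  fix q :: "(complex \<times> real) \<times> real" and v w
  assume "q \<in> (U \<times> UNIV) \<times> UNIV"
  then have q: "hz q \<in> U" by auto
  show "lift_P q \<noteq> 0"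
    using lift_P(1)[OF q] by simp
  show "lorentzian_form (G q)"
    by (rule lorentzian_G[OF q])
  have G: "G q v w = 2 * (c * phi (snd q) * f (hz q)) * (Re (hz v * cnj (hz w))
    + (al q v / (2 * f (hz q)) * (2 / phi (snd q) * snd w + lift_H q * (al q w / (2 * f (hz q))))
      + (2 / phi (snd q) * snd v + lift_H q * (al q v / (2 * f (hz q)))) * (al q w / (2 * f (hz q)))) / 2)"
    using F_zzbar_pos[OF q] phi_pos[of "snd q"]
    unfolding G_def hm_def lift_H_def beta_def by (simp add: field_simps)
  have "sym_prod (\<lambda>v. mu (fst q) (fst v)) (\<lambda>v. cnj (mu (fst q) (fst v))) v w =
      complex_of_real (Re (hz v * cnj (hz w)))"
    by (simp add: sym_prod_def mu_def complex_eq_iff)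
  then show "complex_of_real (G q v w) = 2 * (complex_of_real (lift_P q))\<^sup>2 *
       (sym_prod (\<lambda>v. mu (fst q) (fst v)) (\<lambda>v. cnj (mu (fst q) (fst v))) v w +
        sym_prod (\<lambda>v. complex_of_real (lam (fst q) (fst v)))
          (lift_form mu lam lift_r (\<lambda>_. 0) lift_H q) v w)"
    unfolding of_real_power[symmetric] lift_P(2)[OF q] G
    by (simp add: sym_prod_def lift_form_eq lam_def)
qed (use adapted_coframe_mu_lam smooth_G[OF assms] open_U in
    \<open>auto intro!: smooth_on_const open_Times\<close>)

text \<open>The dual frame is \<open>e\<^sub>1 = (\<partial>\<^sub>x - \<i> \<partial>\<^sub>y) / (2 P)\<close> with horizontal lifts, its conjugate \<open>e\<^sub>2\<close>,
  \<open>e\<^sub>3 = (2 f \<partial>\<^sub>u - H phi \<partial>\<^sub>s / 2) / P\<close> and \<open>e\<^sub>4 = phi \<partial>\<^sub>s / (2 P)\<close>.  The two expressions in the assumption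
  \<open>nonzero\<close> are the real and the negative imaginary part of \<open>c phi C\<^sub>4\<^sub>1\<^sub>3\<^sub>2\<close>.\<close>

lemma petrov_G:
  assumes ric: "\<And>q v w. hz q \<in> U \<Longrightarrow> ricci G q v w = \<kappa> * G q v w"
    and nonzero: "\<And>s. B1 s / 2 * s + beta s - \<kappa> * c / 3 * phi s \<noteq> 0 \<or> B1 s / 2 - s * beta s \<noteq> 0"
  shows "petrov_II_or_D_on ((U \<times> UNIV) \<times> UNIV) G
    (lift_coframe mu lam lift_P lift_r (\<lambda>_. 0) lift_H)"
  unfolding petrov_II_or_D_on_def
proof
  fix q :: "(complex \<times> real) \<times> real"
  assume "q \<in> (U \<times> UNIV) \<times> UNIV"
  then have q: "hz q \<in> U" by auto
  define N where "N = 1 / lift_P q"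
  define t where "t = phi (snd q) * N / 2"
  define a where "a = 2 * f (hz q) * N"
  have N: "lift_P q * N = 1" "N > 0"
    using lift_P(1)[OF q] by (auto simp: N_def)
  have pos: "t > 0" "a > 0" "f (hz q) > 0" "phi (snd q) > 0"
    using N(2) phi_pos[of "snd q"] F_zzbar_pos[OF q] by (simp_all add: t_def a_def)
  define e where "e j = (if j = 1 then (mk q (of_real (N / 2)) 0 0, mk q (- \<i> * of_real (N / 2)) 0 0)
    else if j = 2 then (mk q (of_real (N / 2)) 0 0, mk q (\<i> * of_real (N / 2)) 0 0)
    else if j = 3 then (mk q 0 a (- lift_H q * t), mk q 0 0 0)
    else (mk q 0 0 t, mk q 0 0 0))" for j :: nat
  show "\<exists>e. (\<forall>i\<in>{1..4}. \<forall>j\<in>{1..4}.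
        cx_ext (lift_coframe mu lam lift_P lift_r (\<lambda>_. 0) lift_H i q) (e j) = (if i = j then 1 else 0)) \<and>
      cx_ext4 (weyl G q) (e 4) (e 1) (e 4) (e 1) = 0 \<and>
      cx_ext4 (weyl G q) (e 4) (e 3) (e 4) (e 1) = 0 \<and>
      cx_ext4 (weyl G q) (e 4) (e 1) (e 3) (e (2::nat)) \<noteq> 0"
  proof (intro exI[of _ e] conjI)
    have "{1..4} = {1, 2, 3, 4::nat}"
      by auto
    moreover have PN: "complex_of_real (lift_P q) * complex_of_real N = 1"
      using N(1) by (simp flip: of_real_mult)
    moreover have PiN: "complex_of_real (lift_P q) * (\<i> * complex_of_real N) = \<i>"
      using PN by (simp add: mult.left_commute)
    moreover have "a \<noteq> 0" "t \<noteq> 0" "lift_P q \<noteq> 0"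
      using pos N by auto
    moreover have "lift_P q * (2 / phi (snd q) * t) = 1" "lift_P q * (a / (2 * f (hz q))) = 1"
      "2 / phi (snd q) * (- lift_H q * t) + lift_H q * (a / (2 * f (hz q))) = 0"
      using N pos by (simp_all add: t_def a_def)
    ultimately show "\<forall>i\<in>{1..4}. \<forall>j\<in>{1..4}.
        cx_ext (lift_coframe mu lam lift_P lift_r (\<lambda>_. 0) lift_H i q) (e j) = (if i = j then 1 else 0)"
      by (simp add: cx_ext_def lift_coframe_def e_def mu_def lam_def lift_form_eq PiN del: of_real_add
         flip: of_real_mult)
  next
    note weyl = weyl_components[OF q ric[OF q]]
    show "cx_ext4 (weyl G q) (e 4) (e 1) (e 4) (e 1) = 0"
      "cx_ext4 (weyl G q) (e 4) (e 3) (e 4) (e 1) = 0"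
      by (simp_all add: cx_ext4_def cx_ext_def e_def weyl)
    let ?A = "B1 (snd q) / 2 * snd q + beta (snd q) - \<kappa> * c / 3 * phi (snd q)"
      and ?D = "B1 (snd q) / 2 - snd q * beta (snd q)"
    have "cx_ext4 (weyl G q) (e 4) (e 1) (e 3) (e 2) =
        of_real (t * c * a * N\<^sup>2 * f (hz q)) * Complex ?A (- ?D)"
      by (simp add: cx_ext4_def cx_ext_def e_def weyl hm_def om_def complex_eq_iff power2_eq_square
          algebra_simps)
    moreover have "Complex ?A (- ?D) \<noteq> 0"
      using nonzero[of "snd q"]
      by (simp only: complex_eq_iff complex.sel zero_complex.sel neg_equal_0_iff_equal) blast
    ultimately show "cx_ext4 (weyl G q) (e 4) (e 1) (e 3) (e 2) \<noteq> 0"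
      using pos N c_pos by simp
  qed
qed

end

section \<open>Existence of the Einstein lift\<close>

theorem theorem1p3:
  fixes U :: "complex set" and F :: "complex \<Rightarrow> real" and \<Lambda>\<^sub>o \<Lambda> :: real
  assumes "open U"
    and "smooth_on U F"
    and "sasakian_manifold3 (U \<times> UNIV) (hyp_D F) (hyp_J F) (\<lambda>_. (0, 1))"
    and "\<forall>z\<in>U. F_zzbar F z > 0"
    and "einstein_on U (kaehler_metric F) \<Lambda>\<^sub>o"
    and "\<Lambda>\<^sub>o \<noteq> 0"
    and "\<Lambda> * \<Lambda>\<^sub>o > 0"
  shows "\<exists>g \<mu> lam P r W H.
    lift_of (U \<times> UNIV) (hyp_D F) (hyp_J F) g \<mu> lam P r W H \<and>
    petrov_II_or_D_on ((U \<times> UNIV) \<times> UNIV) g (lift_coframe \<mu> lam P r W H) \<and>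
    einstein_on ((U \<times> UNIV) \<times> UNIV) g \<Lambda>"
proof -
  define c where "c = 3 * \<Lambda>\<^sub>o / (4 * \<Lambda>)"
  \<comment> \<open>The first summand of \<open>B\<close> gives constant curvature; the second one, the real part of
    \<open>1 / (s - \<i>)\<close>, solves the homogeneous equations and carries the Weyl tensor.\<close>
  define B B1 B2 :: "real \<Rightarrow> real" where
    "B s = \<Lambda>\<^sub>o / 4 * (1 + s\<^sup>2) + s / (1 + s\<^sup>2)" and
    "B1 s = \<Lambda>\<^sub>o / 2 * s + (1 - s\<^sup>2) / (1 + s\<^sup>2)\<^sup>2" and
    "B2 s = \<Lambda>\<^sub>o / 2 + (2 * s ^ 3 - 6 * s) / (1 + s\<^sup>2) ^ 3" for s
  have "\<Lambda> \<noteq> 0" "c > 0"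
    using assms(7) by (auto simp: c_def zero_less_mult_iff divide_pos_pos divide_neg_neg)
  then have c: "\<Lambda> * c = 3 * \<Lambda>\<^sub>o / 4"
    by (simp add: c_def)
  have pos: "1 + s\<^sup>2 > 0" "1 + s\<^sup>2 \<noteq> 0" for s :: real
    by (simp_all add: add_pos_nonneg add_nonneg_eq_0_iff)
  have "smooth_on UNIV B"
    unfolding B_def power2_eq_square
    using pos(1) by (intro smooth_on_add smooth_on_mult smooth_on_divide smooth_on_const smooth_on_ident
      open_UNIV) (auto simp: power2_eq_square)
  interpret sasakian_lift U F \<Lambda>\<^sub>o c B B1 B2
  proof
    show "(B has_real_derivative B1 s) (at s)" for s
      unfolding B_def B1_def
      by (auto intro!: derivative_eq_intros simp: pos)
        (simp add: pos divide_simps, simp add: algebra_simps power2_eq_square)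
    show "(B1 has_real_derivative B2 s) (at s)" for s
      unfolding B1_def B2_def
      by (auto intro!: derivative_eq_intros simp: pos) (simp add: pos divide_simps, algebra)
  qed (use assms \<open>c > 0\<close> in auto)
  have beta: "beta s = \<Lambda>\<^sub>o / 4 + s / (1 + s\<^sup>2)\<^sup>2" for s
    using pos[of s] by (simp add: beta_def phi_def B_def divide_simps) algebra
  have "\<Lambda>\<^sub>o - 2 * beta s + s * B1 s + B s = \<Lambda> * c * phi s" for s
    unfolding c beta phi_def B_def B1_def using pos[of s]
    by (simp add: divide_simps) algebra
  moreover have "B2 s / 2 + (s * B1 s + 2 * beta s) / phi s = \<Lambda> * c" for s
    unfolding c beta phi_def B2_def B1_def using pos[of s]
    by (simp add: divide_simps) algebra
  ultimately have ric: "ricci G q v w = \<Lambda> * G q v w" if "hz q \<in> U" for q v w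
    using einstein_G that by blast
  have "B1 s / 2 * s + beta s - \<Lambda> * c / 3 * phi s \<noteq> 0 \<or> B1 s / 2 - s * beta s \<noteq> 0" for s
  proof -
    have "B1 s / 2 * s + beta s - \<Lambda> * c / 3 * phi s = s * (3 - s\<^sup>2) / (2 * (1 + s\<^sup>2)\<^sup>2)"
      unfolding c beta phi_def B1_def using pos[of s]
      by (simp add: divide_simps) algebra
    moreover have "B1 s / 2 - s * beta s = (1 - 3 * s\<^sup>2) / (2 * (1 + s\<^sup>2)\<^sup>2)"
      unfolding beta B1_def using pos[of s]
      by (simp add: divide_simps) algebra
    moreover have "s * (3 - s\<^sup>2) \<noteq> 0 \<or> 1 - 3 * s\<^sup>2 \<noteq> 0"
      by auto
    ultimately show ?thesis
      using pos[of s] by auto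
  qed
  from petrov_G[OF ric this] lift_of_G[OF \<open>smooth_on UNIV B\<close>] ric show ?thesis
    by (intro exI conjI) (auto simp: einstein_on_def)
qed

end
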